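(* Let $\mathcal{L}$ be a left Hopf algebroid over a unital algebra $B$ and let $\Gamma$ be a convolution-invertible $B$-bilinear left 2-cocycle on $\mathcal{L}$. Then $\mathcal{L}^\Gamma\cong\mathcal{L}^\Gamma_D$ as left Hopf algebroids. The isomorphism is given by $$\Psi:\mathcal{L}^\Gamma\to\mathcal{L}^\Gamma_D,\qquad \Psi(X)=\overline{\Gamma(X_{(2)+},X_{(2)-})}\,X_{(1)},$$ with inverse $$\Psi^{-1}(X)=X_{(1)+}\,\overline{\Gamma^{-1}(X_{(1)-},X_{(2)})}$$ for all $X\in\mathcal{L}$.
   Context: All algebras are unital over a field $\mathbb{K}$ and $\otimes$ is over $\mathbb K$. $\overline{B}$ is the opposite algebra of $B$, with anti-isomorphism $b\mapsto\overline b$, and $B^e=B\otimes\overline B$. Standing assumption: all $B$-module and $\overline B$-module structures are faithfully flat. Left bialgebroid over $B$: a unital algebra $\mathcal{L}$ with algebra maps $s:B\to\mathcal{L}$, $t:B^{op}\to\mathcal{L}$ with commuting images; in $\mathcal{L}$ one writes $b$ for $s(b)$ and $\overline b$ for $t(b)$. Put $P\diamond_B Q=P\otimes Q/\langle \overline b p\otimes q-p\otimes bq\rangle$. With the $B$-bimodule structure $a.X.b=a\overline bX$, $\mathcal{L}$ is a $B$-coring with coproduct $\Delta:\mathcal{L}\to\mathcal{L}\diamond_B\mathcal{L}$, $\Delta(X)=X_{(1)}\diamond X_{(2)}$, and counit $\varepsilon:\mathcal{L}\to B$, such that (i) $\Delta$ has image in the Takeuchi product $\{\sum_i X_i\diamond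 Y_i: \sum_i X_i\overline b\diamond Y_i=\sum_i X_i\diamond Y_ib\ \forall b\in B\}$ and is an algebra map into it (factorwise product); (ii) $\varepsilon(1)=1$ and $\varepsilon(X\varepsilon(Y))=\varepsilon(XY)=\varepsilon(X\overline{\varepsilon(Y)})$. $\mathcal{L}$ is a left Hopf algebroid if $\lambda:\mathcal{L}\otimes_{\overline B}\mathcal{L}\to\mathcal{L}\diamond_B\mathcal{L}$, $\lambda(X\otimes Y)=X_{(1)}\diamond X_{(2)}Y$ is invertible, where $\mathcal{L}\otimes_{\overline B}\mathcal{L}=\mathcal{L}\otimes\mathcal{L}/\langle X\overline b\otimes Y-X\otimes\overline bY\rangle$; write $X_+\otimes_{\overline B}X_-=\lambda^{-1}(X\diamond 1)$. A convolution-invertible $B$-bilinear left 2-cocycle is a left $B^e$-linear map $\Gamma:\mathcal{L}\otimes_{B^e}\mathcal{L}\to B$ (so $\Gamma(a\overline bX,Y)=a\Gamma(X,Y)b$ and $\Gamma(Xa\overline b,Y)=\Gamma(X,a\overline bY)$) such that (i) $\Gamma(X,\Gamma(Y_{(1)},Z_{(1)})Y_{(2)}Z_{(2)})=\Gamma(\Gamma(X_{(1)},Y_{(1)})X_{(2)}Y_{(2)},Z)$; (ii) $\Gamma(1,X)=\varepsilon(X)=\Gamma(X,1)$; (iii) $\Gamma(X,Yb)=\Gamma(X,Y\overline b)$; and which is invertible under convolution $(f*g)(X,Y)=f(X_{(1)},Y_{(1)})g(X_{(2)},Y_{(2)})$ on left $B^e$-linear maps $\mathcal{L}\otimes_{B^e}\mathcal{L}\to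 B$, with unit $(X,Y)\mapsto\varepsilon(XY)$; the convolution inverse is $\Gamma^{-1}$. Drinfeld cotwist $\mathcal{L}^\Gamma_D$: the left Hopf algebroid over $B$ with the original coring structure (and the same $s,t$) of $\mathcal{L}$ and product $X\ast_\Gamma Y=\Gamma(X_{(1)},Y_{(1)})\,\overline{\Gamma^{-1}(X_{(3)},Y_{(3)})}\,X_{(2)}Y_{(2)}$. Such a $\Gamma$, viewed as a map on $\mathcal{L}\otimes_{\overline B}\mathcal{L}$ by composition with the projection $\mathcal{L}\otimes_{\overline B}\mathcal{L}\to\mathcal{L}\otimes_{B^e}\mathcal{L}$, defines another left Hopf algebroid $\mathcal{L}^\Gamma$ over the base $B^\Gamma$, which is the vector space $B$ with product $\Gamma(s(a),s(b))$; here $B^\Gamma=B$. $\mathcal{L}^\Gamma$ is the vector space $\mathcal{L}$ with the same $s,t$, product $X\cdot_\Gamma Y=\Gamma(X_{(1)},Y_{(1)})\,X_{(2)+}Y_{(2)+}\,\overline{\Gamma(Y_{(2)-},X_{(2)-})}$, coproduct $\Delta^\Gamma=(\Gamma^\#)^{-1}\circ\Delta$ and counit $\varepsilon^\Gamma(X)=\Gamma(X_+,X_-)$, where $\Gamma^\#:\mathcal{L}^\Gamma\diamond_{B^\Gamma}\mathcal{L}^\Gamma\to\mathcal{L}\diamond_B\mathcal{L}$, $\Gamma^\#(X\diamond Y)=X_+\overline{\Gamma(X_-,Y_{(1)})}\diamond Y_{(2)}$ is invertible and $\mathcal{L}^\Gamma\diamond_{B^\Gamma}\mathcal{L}^\Gamma=\mathcal{L}\otimes\mathcal{L}/\langle\overline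 b\cdot_\Gamma X\otimes Y-X\otimes b\cdot_\Gamma Y\rangle$. Isomorphism of left Hopf algebroids over $B$: a bijective algebra map compatible with source and target maps, coproducts and counits. *)

theory Defs
  imports Complex_Main "HOL-Library.Multiset" "HOL-Algebra.Module"
begin

section \<open>Unital algebras over a field\<close>

record ('k, 'a) alg =
  scal :: "'k \<Rightarrow> 'a \<Rightarrow> 'a"
  amult :: "'a \<Rightarrow> 'a \<Rightarrow> 'a" (infixl "\<cdot>\<index>" 70)
  aone :: 'a ("\<^bold>1\<index>")

definition unital_algebra :: "('k::field, 'a::ab_group_add, 'z) alg_scheme \<Rightarrow> bool" where
  "unital_algebra A \<longleftrightarrow>
     vector_space (scal A) \<and>
     (\<forall>x. Vector_Spaces.linear (scal A) (scal A) (\<lambda>y. x \<cdot>\<^bsub>A\<^esub> y)) \<and>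
     (\<forall>y. Vector_Spaces.linear (scal A) (scal A) (\<lambda>x. x \<cdot>\<^bsub>A\<^esub> y)) \<and>
     (\<forall>x y z. (x \<cdot>\<^bsub>A\<^esub> y) \<cdot>\<^bsub>A\<^esub> z = x \<cdot>\<^bsub>A\<^esub> (y \<cdot>\<^bsub>A\<^esub> z)) \<and>
     (\<forall>x. \<^bold>1\<^bsub>A\<^esub> \<cdot>\<^bsub>A\<^esub> x = x \<and> x \<cdot>\<^bsub>A\<^esub> \<^bold>1\<^bsub>A\<^esub> = x)"

definition opposite :: "('k, 'a) alg \<Rightarrow> ('k, 'a) alg" where
  "opposite A = A\<lparr>amult := \<lambda>x y. y \<cdot>\<^bsub>A\<^esub> x\<rparr>"

definition algebra_map ::
  "('k::field, 'a::ab_group_add, 'y) alg_scheme \<Rightarrow> ('k, 'c::ab_group_add, 'z) alg_scheme \<Rightarrow>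
     ('a \<Rightarrow> 'c) \<Rightarrow> bool" where
  "algebra_map A C f \<longleftrightarrow>
     Vector_Spaces.linear (scal A) (scal C) f \<and> f \<^bold>1\<^bsub>A\<^esub> = \<^bold>1\<^bsub>C\<^esub> \<and>
     (\<forall>x y. f (x \<cdot>\<^bsub>A\<^esub> y) = f x \<cdot>\<^bsub>C\<^esub> f y)"


section \<open>Modules and balanced tensor products\<close>

text \<open>
  The \<open>module\<close> locale of \<open>HOL-Algebra\<close> requires a commutative ring of scalars, so only its record
  type is used; the \<open>mult\<close> and \<open>one\<close> fields of the record play no role.  A right module over
  \<open>A\<close> is a left module over the opposite algebra, and \<open>r \<odot>\<^bsub>M\<^esub> x\<close> then stands for \<open>x r\<close>.
\<close>

definition left_module :: "('k, 'r::ab_group_add) alg \<Rightarrow> ('r, 'm) module \<Rightarrow> bool" where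
  "left_module A M \<longleftrightarrow>
     abelian_group M \<and>
     (\<forall>r. \<forall>x\<in>carrier M. r \<odot>\<^bsub>M\<^esub> x \<in> carrier M) \<and>
     (\<forall>r. \<forall>x\<in>carrier M. \<forall>y\<in>carrier M. r \<odot>\<^bsub>M\<^esub> (x \<oplus>\<^bsub>M\<^esub> y) = r \<odot>\<^bsub>M\<^esub> x \<oplus>\<^bsub>M\<^esub> r \<odot>\<^bsub>M\<^esub> y) \<and>
     (\<forall>r r'. \<forall>x\<in>carrier M. (r + r') \<odot>\<^bsub>M\<^esub> x = r \<odot>\<^bsub>M\<^esub> x \<oplus>\<^bsub>M\<^esub> r' \<odot>\<^bsub>M\<^esub> x) \<and>
     (\<forall>r r'. \<forall>x\<in>carrier M. (r \<cdot>\<^bsub>A\<^esub> r') \<odot>\<^bsub>M\<^esub> x = r \<odot>\<^bsub>M\<^esub> (r' \<odot>\<^bsub>M\<^esub> x)) \<and>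
     (\<forall>x\<in>carrier M. \<^bold>1\<^bsub>A\<^esub> \<odot>\<^bsub>M\<^esub> x = x)"

abbreviation right_module :: "('k, 'r::ab_group_add) alg \<Rightarrow> ('r, 'm) module \<Rightarrow> bool" where
  "right_module A M \<equiv> left_module (opposite A) M"

definition module_map :: "('r, 'm) module \<Rightarrow> ('r, 'n) module \<Rightarrow> ('m \<Rightarrow> 'n) \<Rightarrow> bool" where
  "module_map M N f \<longleftrightarrow>
     (\<forall>x\<in>carrier M. f x \<in> carrier N) \<and>
     (\<forall>x\<in>carrier M. \<forall>y\<in>carrier M. f (x \<oplus>\<^bsub>M\<^esub> y) = f x \<oplus>\<^bsub>N\<^esub> f y) \<and>
     (\<forall>r. \<forall>x\<in>carrier M. f (r \<odot>\<^bsub>M\<^esub> x) = r \<odot>\<^bsub>N\<^esub> f x)"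

text \<open>
  The tensor product of a right module \<open>M\<close> and a left module \<open>N\<close> is realised as formal finite sums
  (multisets) of pairs \<open>(x, y)\<close>, standing for \<open>x \<otimes> y\<close>, modulo the smallest congruence containing
  the defining relations.  Negative coefficients are not needed because \<open>-(x \<otimes> y) = (-x) \<otimes> y\<close>.
  Over a \<open>\<bbbK>\<close>-algebra, balancing over the algebra includes balancing over \<open>\<bbbK>\<close>.
\<close>

inductive_set formal_cong ::
  "('x multiset \<Rightarrow> 'x multiset \<Rightarrow> bool) \<Rightarrow> ('x multiset \<times> 'x multiset) set"
  for R :: "'x multiset \<Rightarrow> 'x multiset \<Rightarrow> bool" where
  step: "R u v \<Longrightarrow> (u, v) \<in> formal_cong R"
| refl: "(u, u) \<in> formal_cong R"
| sym: "(u, v) \<in> formal_cong R \<Longrightarrow> (v, u) \<in> formal_cong R"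
| trans: "(u, v) \<in> formal_cong R \<Longrightarrow> (v, w) \<in> formal_cong R \<Longrightarrow> (u, w) \<in> formal_cong R"
| plus: "(u, v) \<in> formal_cong R \<Longrightarrow> (u + w, v + w) \<in> formal_cong R"

inductive tensor_step ::
  "('r, 'm) module \<Rightarrow> ('r, 'n) module \<Rightarrow> ('m \<times> 'n) multiset \<Rightarrow> ('m \<times> 'n) multiset \<Rightarrow> bool"
  for M :: "('r, 'm) module" and N :: "('r, 'n) module" where
  add_left: "\<lbrakk>x \<in> carrier M; x' \<in> carrier M; y \<in> carrier N\<rbrakk> \<Longrightarrow>
     tensor_step M N {#(x \<oplus>\<^bsub>M\<^esub> x', y)#} {#(x, y), (x', y)#}"
| add_right: "\<lbrakk>x \<in> carrier M; y \<in> carrier N; y' \<in> carrier N\<rbrakk> \<Longrightarrow>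
     tensor_step M N {#(x, y \<oplus>\<^bsub>N\<^esub> y')#} {#(x, y), (x, y')#}"
| zero_left: "y \<in> carrier N \<Longrightarrow> tensor_step M N {#(\<zero>\<^bsub>M\<^esub>, y)#} {#}"
| zero_right: "x \<in> carrier M \<Longrightarrow> tensor_step M N {#(x, \<zero>\<^bsub>N\<^esub>)#} {#}"
| balanced: "\<lbrakk>x \<in> carrier M; y \<in> carrier N\<rbrakk> \<Longrightarrow>
     tensor_step M N {#(r \<odot>\<^bsub>M\<^esub> x, y)#} {#(x, r \<odot>\<^bsub>N\<^esub> y)#}"

abbreviation tensor_cong ::
  "('r, 'm) module \<Rightarrow> ('r, 'n) module \<Rightarrow> (('m \<times> 'n) multiset \<times> ('m \<times> 'n) multiset) set" where
  "tensor_cong M N \<equiv> formal_cong (tensor_step M N)"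

definition tensor :: "('r, 'm) module \<Rightarrow> ('r, 'n) module \<Rightarrow> ('m \<times> 'n) multiset set set" where
  "tensor M N = {u. set_mset u \<subseteq> carrier M \<times> carrier N} // tensor_cong M N"

text \<open>
  A map given on formal sums is applied to a class by applying it to all representatives and closing
  the result up under the congruence of the target; if it respects the congruences, this is the
  induced map between the quotients.
\<close>

definition induced :: "('y multiset \<times> 'y multiset) set \<Rightarrow> ('x multiset \<Rightarrow> 'y multiset) \<Rightarrow>
    'x multiset set \<Rightarrow> 'y multiset set" where
  "induced E \<phi> T = E `` (\<phi> ` T)"

definition exact :: "'x set \<Rightarrow> 'y set \<Rightarrow> 'z \<Rightarrow> ('x \<Rightarrow> 'y) \<Rightarrow> ('y \<Rightarrow> 'z) \<Rightarrow> bool" where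
  "exact X Y z f g \<longleftrightarrow> f ` X = {y \<in> Y. g y = z}"

text \<open>
  The test modules have carriers in the type \<open>(nat \<Rightarrow> 'r) set\<close>, which contains a copy (by cosets
  in \<open>A\<^sup>(\<^sup>\<nat>\<^sup>)\<close>) of every countably generated right module, in particular of all right ideals and all
  cyclic right modules.  As flatness and faithfulness can be tested on these, the definition agrees
  with the one quantifying over all right modules.
\<close>

definition faithfully_flat :: "('k, 'r::ab_group_add) alg \<Rightarrow> ('r, 'n) module \<Rightarrow> bool" where
  "faithfully_flat A N \<longleftrightarrow>
     left_module A N \<and>
     (\<forall>(P :: ('r, (nat \<Rightarrow> 'r) set) module) (Q :: ('r, (nat \<Rightarrow> 'r) set) module)
        (R :: ('r, (nat \<Rightarrow> 'r) set) module) f g.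
        right_module A P \<and> right_module A Q \<and> right_module A R \<and>
        module_map P Q f \<and> module_map Q R g \<longrightarrow>
        (exact (carrier P) (carrier Q) \<zero>\<^bsub>R\<^esub> f g \<longleftrightarrow>
         exact (tensor P N) (tensor Q N) (tensor_cong R N `` {{#}})
           (induced (tensor_cong Q N) (image_mset (map_prod f id)))
           (induced (tensor_cong R N) (image_mset (map_prod g id)))))"


section \<open>Left Hopf algebroids\<close>

text \<open>
  The coproduct takes values in classes of formal sums of pairs; \<open>left_bialgebroid\<close> below requires
  them to be elements of the tensor product over the base.
\<close>

record ('k, 'b, 'l) algebroid = "('k, 'l) alg" +
  base :: "('k, 'b) alg"
  src :: "'b \<Rightarrow> 'l"
  tgt :: "'b \<Rightarrow> 'l"
  cop :: "'l \<Rightarrow> ('l \<times> 'l) multiset set"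
  cou :: "'l \<Rightarrow> 'b"

definition action_module :: "('b \<Rightarrow> 'l \<Rightarrow> 'l) \<Rightarrow> ('b, 'l::ab_group_add) module" where
  "action_module act =
     \<lparr>carrier = UNIV, mult = undefined, one = undefined, zero = 0, add = (+), smult = act\<rparr>"

abbreviation src_left :: "('k, 'b, 'l::ab_group_add) algebroid \<Rightarrow> ('b, 'l) module" where
  "src_left L \<equiv> action_module (\<lambda>b X. src L b \<cdot>\<^bsub>L\<^esub> X)"

abbreviation tgt_left :: "('k, 'b, 'l::ab_group_add) algebroid \<Rightarrow> ('b, 'l) module" where
  "tgt_left L \<equiv> action_module (\<lambda>b X. tgt L b \<cdot>\<^bsub>L\<^esub> X)"

abbreviation src_right :: "('k, 'b, 'l::ab_group_add) algebroid \<Rightarrow> ('b, 'l) module" where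
  "src_right L \<equiv> action_module (\<lambda>b X. X \<cdot>\<^bsub>L\<^esub> src L b)"

abbreviation tgt_right :: "('k, 'b, 'l::ab_group_add) algebroid \<Rightarrow> ('b, 'l) module" where
  "tgt_right L \<equiv> action_module (\<lambda>b X. X \<cdot>\<^bsub>L\<^esub> tgt L b)"

text \<open>
  Equality in \<open>L \<diamondop>\<^sub>B L\<close> (relations \<open>t(b) p \<otimes> q = p \<otimes> s(b) q\<close>) and in \<open>L \<otimes> L\<close> over the opposite
  algebra of \<open>B\<close> (relations \<open>X t(b) \<otimes> Y = X \<otimes> t(b) Y\<close>).
\<close>

abbreviation dia :: "('k, 'b, 'l::ab_group_add) algebroid \<Rightarrow>
    (('l \<times> 'l) multiset \<times> ('l \<times> 'l) multiset) set" where
  "dia L \<equiv> tensor_cong (tgt_left L) (src_left L)"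

abbreviation otb :: "('k, 'b, 'l::ab_group_add) algebroid \<Rightarrow>
    (('l \<times> 'l) multiset \<times> ('l \<times> 'l) multiset) set" where
  "otb L \<equiv> tensor_cong (tgt_right L) (tgt_left L)"

inductive dia3_step :: "('k, 'b, 'l::ab_group_add) algebroid \<Rightarrow>
    ('l \<times> 'l \<times> 'l) multiset \<Rightarrow> ('l \<times> 'l \<times> 'l) multiset \<Rightarrow> bool"
  for L :: "('k, 'b, 'l) algebroid" where
  "dia3_step L {#(x + x', y, z)#} {#(x, y, z), (x', y, z)#}"
| "dia3_step L {#(x, y + y', z)#} {#(x, y, z), (x, y', z)#}"
| "dia3_step L {#(x, y, z + z')#} {#(x, y, z), (x, y, z')#}"
| "dia3_step L {#(0, y, z)#} {#}"
| "dia3_step L {#(x, 0, z)#} {#}"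
| "dia3_step L {#(x, y, 0)#} {#}"
| "dia3_step L {#(tgt L b \<cdot>\<^bsub>L\<^esub> x, y, z)#} {#(x, src L b \<cdot>\<^bsub>L\<^esub> y, z)#}"
| "dia3_step L {#(x, tgt L b \<cdot>\<^bsub>L\<^esub> y, z)#} {#(x, y, src L b \<cdot>\<^bsub>L\<^esub> z)#}"

text \<open>
  Sweedler notation: an expression in \<open>X\<^sub>(\<^sub>1\<^sub>)\<close>, \<open>X\<^sub>(\<^sub>2\<^sub>)\<close> is evaluated on some formal sum representing
  \<open>\<Delta>(X)\<close>.  The values below do not depend on this choice.  Expressions in the components of two
  elements \<open>X\<close> and \<open>Y\<close> are in general not balanced in the components of \<open>Y\<close> for fixed components
  of \<open>X\<close>, but only after summing over \<open>\<Delta>(X)\<close>, because \<open>\<Delta>(X)\<close> lies in the Takeuchi product.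
\<close>

definition rep :: "'x multiset set \<Rightarrow> 'x multiset" where
  "rep T = (SOME u. u \<in> T)"

abbreviation sw :: "('k, 'b, 'l) algebroid \<Rightarrow> 'l \<Rightarrow> ('l \<times> 'l) multiset" where
  "sw L X \<equiv> rep (cop L X)"

definition sw3 :: "('k, 'b, 'l) algebroid \<Rightarrow> 'l \<Rightarrow> ('l \<times> 'l \<times> 'l) multiset" where
  "sw3 L X = (\<Sum>(x1, x')\<in>#sw L X. {#(x1, x2, x3). (x2, x3) \<in># sw L x'#})"

definition left_bialgebroid ::
  "('k::field, 'b::ab_group_add, 'l::ab_group_add) algebroid \<Rightarrow> bool" where
  "left_bialgebroid L \<longleftrightarrow>
     \<comment> \<open>algebras, source and target\<close>
     unital_algebra (base L) \<and> unital_algebra L \<and>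
     algebra_map (base L) L (src L) \<and> algebra_map (opposite (base L)) L (tgt L) \<and>
     (\<forall>a b. src L a \<cdot>\<^bsub>L\<^esub> tgt L b = tgt L b \<cdot>\<^bsub>L\<^esub> src L a) \<and>
     \<comment> \<open>\<open>\<Delta>\<close> is a bimodule map into \<open>L \<diamondop>\<^sub>B L\<close>\<close>
     (\<forall>X. cop L X \<in> UNIV // dia L) \<and>
     (\<forall>X Y. \<forall>u\<in>cop L X. \<forall>v\<in>cop L Y. u + v \<in> cop L (X + Y)) \<and>
     (\<forall>a b X. \<forall>u\<in>cop L X.
        {#(src L a \<cdot>\<^bsub>L\<^esub> x1, tgt L b \<cdot>\<^bsub>L\<^esub> x2). (x1, x2) \<in># u#}
          \<in> cop L (src L a \<cdot>\<^bsub>L\<^esub> tgt L b \<cdot>\<^bsub>L\<^esub> X)) \<and>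
     \<comment> \<open>\<open>\<epsilon>\<close> is a bimodule map\<close>
     (\<forall>X Y. cou L (X + Y) = cou L X + cou L Y) \<and>
     (\<forall>a b X. cou L (src L a \<cdot>\<^bsub>L\<^esub> tgt L b \<cdot>\<^bsub>L\<^esub> X) = a \<cdot>\<^bsub>base L\<^esub> cou L X \<cdot>\<^bsub>base L\<^esub> b) \<and>
     \<comment> \<open>coassociativity and counit\<close>
     (\<forall>X. ((\<Sum>(x', x3)\<in>#sw L X. {#(x1, x2, x3). (x1, x2) \<in># sw L x'#}), sw3 L X)
        \<in> formal_cong (dia3_step L)) \<and>
     (\<forall>X. (\<Sum>(x1, x2)\<in>#sw L X. src L (cou L x1) \<cdot>\<^bsub>L\<^esub> x2) = X) \<and>
     (\<forall>X. (\<Sum>(x1, x2)\<in>#sw L X. tgt L (cou L x2) \<cdot>\<^bsub>L\<^esub> x1) = X) \<and>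
     \<comment> \<open>\<open>\<Delta>\<close> is an algebra map into the Takeuchi product\<close>
     (\<forall>X b. \<forall>u\<in>cop L X.
        ({#(x1 \<cdot>\<^bsub>L\<^esub> tgt L b, x2). (x1, x2) \<in># u#},
         {#(x1, x2 \<cdot>\<^bsub>L\<^esub> src L b). (x1, x2) \<in># u#}) \<in> dia L) \<and>
     {#(\<^bold>1\<^bsub>L\<^esub>, \<^bold>1\<^bsub>L\<^esub>)#} \<in> cop L \<^bold>1\<^bsub>L\<^esub> \<and>
     (\<forall>X Y. \<forall>u\<in>cop L X. \<forall>v\<in>cop L Y.
        (\<Sum>(x1, x2)\<in>#u. {#(x1 \<cdot>\<^bsub>L\<^esub> y1, x2 \<cdot>\<^bsub>L\<^esub> y2). (y1, y2) \<in># v#}) \<in> cop L (X \<cdot>\<^bsub>L\<^esub> Y)) \<and>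
     \<comment> \<open>multiplicative properties of \<open>\<epsilon>\<close>\<close>
     cou L \<^bold>1\<^bsub>L\<^esub> = \<^bold>1\<^bsub>base L\<^esub> \<and>
     (\<forall>X Y. cou L (X \<cdot>\<^bsub>L\<^esub> src L (cou L Y)) = cou L (X \<cdot>\<^bsub>L\<^esub> Y) \<and>
            cou L (X \<cdot>\<^bsub>L\<^esub> tgt L (cou L Y)) = cou L (X \<cdot>\<^bsub>L\<^esub> Y))"

definition galois :: "('k, 'b, 'l::ab_group_add) algebroid \<Rightarrow>
    ('l \<times> 'l) multiset set \<Rightarrow> ('l \<times> 'l) multiset set" where
  "galois L = induced (dia L)
     (\<lambda>u. \<Sum>(X, Y)\<in>#u. {#(x1, x2 \<cdot>\<^bsub>L\<^esub> Y). (x1, x2) \<in># sw L X#})"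

definition left_hopf_algebroid ::
  "('k::field, 'b::ab_group_add, 'l::ab_group_add) algebroid \<Rightarrow> bool" where
  "left_hopf_algebroid L \<longleftrightarrow>
     left_bialgebroid L \<and> bij_betw (galois L) (UNIV // otb L) (UNIV // dia L)"

text \<open>A formal sum representing \<open>X\<^sub>+ \<otimes> X\<^sub>-\<close>.\<close>

definition pm :: "('k, 'b, 'l::ab_group_add) algebroid \<Rightarrow> 'l \<Rightarrow> ('l \<times> 'l) multiset" where
  "pm L X = rep (the_inv_into (UNIV // otb L) (galois L) (dia L `` {{#(X, \<^bold>1\<^bsub>L\<^esub>)#}}))"

text \<open>
  Right \<open>B\<close>-modules are left modules over the opposite algebra of \<open>B\<close>, and right modules over the
  latter are left \<open>B\<close>-modules.
\<close>

definition faithfully_flat_over_base ::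
  "('k, 'b::ab_group_add, 'l::ab_group_add) algebroid \<Rightarrow> bool" where
  "faithfully_flat_over_base L \<longleftrightarrow>
     faithfully_flat (base L) (src_left L) \<and>
     faithfully_flat (opposite (base L)) (src_right L) \<and>
     faithfully_flat (opposite (base L)) (tgt_left L) \<and>
     faithfully_flat (base L) (tgt_right L)"

definition hopf_algebroid_iso ::
  "('k::field, 'b::ab_group_add, 'l::ab_group_add) algebroid \<Rightarrow>
   ('k, 'b, 'm::ab_group_add) algebroid \<Rightarrow> ('l \<Rightarrow> 'm) \<Rightarrow> bool" where
  "hopf_algebroid_iso L M f \<longleftrightarrow>
     base L = base M \<and> bij f \<and> algebra_map L M f \<and>
     (\<forall>b. f (src L b) = src M b) \<and> (\<forall>b. f (tgt L b) = tgt M b) \<and>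
     (\<forall>X. induced (dia M) (image_mset (map_prod f f)) (cop L X) = cop M (f X)) \<and>
     (\<forall>X. cou M (f X) = cou L X)"


section \<open>Cocycles and cotwists\<close>

text \<open>Left \<open>B\<^sup>e\<close>-linear maps from \<open>L \<otimes> L\<close> over \<open>B\<^sup>e\<close> to \<open>B\<close>, as balanced biadditive maps.\<close>

definition Be_linear :: "('k, 'b::ab_group_add, 'l::ab_group_add) algebroid \<Rightarrow>
    ('l \<Rightarrow> 'l \<Rightarrow> 'b) \<Rightarrow> bool" where
  "Be_linear L f \<longleftrightarrow>
     (\<forall>X X' Y. f (X + X') Y = f X Y + f X' Y) \<and>
     (\<forall>X Y Y'. f X (Y + Y') = f X Y + f X Y') \<and>
     (\<forall>a b X Y. f (src L a \<cdot>\<^bsub>L\<^esub> tgt L b \<cdot>\<^bsub>L\<^esub> X) Y = a \<cdot>\<^bsub>base L\<^esub> f X Y \<cdot>\<^bsub>base L\<^esub> b) \<and>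
     (\<forall>a b X Y. f (X \<cdot>\<^bsub>L\<^esub> src L a \<cdot>\<^bsub>L\<^esub> tgt L b) Y = f X (src L a \<cdot>\<^bsub>L\<^esub> tgt L b \<cdot>\<^bsub>L\<^esub> Y))"

definition convolution :: "('k, 'b::ab_group_add, 'l) algebroid \<Rightarrow>
    ('l \<Rightarrow> 'l \<Rightarrow> 'b) \<Rightarrow> ('l \<Rightarrow> 'l \<Rightarrow> 'b) \<Rightarrow> 'l \<Rightarrow> 'l \<Rightarrow> 'b" where
  "convolution L f g X Y =
     (\<Sum>(x1, x2)\<in>#sw L X. \<Sum>(y1, y2)\<in>#sw L Y. f x1 y1 \<cdot>\<^bsub>base L\<^esub> g x2 y2)"

definition convolution_inverse :: "('k, 'b::ab_group_add, 'l::ab_group_add) algebroid \<Rightarrow>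
    ('l \<Rightarrow> 'l \<Rightarrow> 'b) \<Rightarrow> ('l \<Rightarrow> 'l \<Rightarrow> 'b) \<Rightarrow> bool" where
  "convolution_inverse L f g \<longleftrightarrow>
     Be_linear L g \<and>
     convolution L f g = (\<lambda>X Y. cou L (X \<cdot>\<^bsub>L\<^esub> Y)) \<and>
     convolution L g f = (\<lambda>X Y. cou L (X \<cdot>\<^bsub>L\<^esub> Y))"

definition left_twisted_mult :: "('k, 'b, 'l::ab_group_add) algebroid \<Rightarrow>
    ('l \<Rightarrow> 'l \<Rightarrow> 'b) \<Rightarrow> 'l \<Rightarrow> 'l \<Rightarrow> 'l" where
  "left_twisted_mult L \<Gamma> X Y =
     (\<Sum>(x1, x2)\<in>#sw L X. \<Sum>(y1, y2)\<in>#sw L Y. src L (\<Gamma> x1 y1) \<cdot>\<^bsub>L\<^esub> (x2 \<cdot>\<^bsub>L\<^esub> y2))"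

definition bilinear_left_2_cocycle :: "('k, 'b::ab_group_add, 'l::ab_group_add) algebroid \<Rightarrow>
    ('l \<Rightarrow> 'l \<Rightarrow> 'b) \<Rightarrow> bool" where
  "bilinear_left_2_cocycle L \<Gamma> \<longleftrightarrow>
     Be_linear L \<Gamma> \<and>
     (\<forall>X Y Z. \<Gamma> X (left_twisted_mult L \<Gamma> Y Z) = \<Gamma> (left_twisted_mult L \<Gamma> X Y) Z) \<and>
     (\<forall>X. \<Gamma> \<^bold>1\<^bsub>L\<^esub> X = cou L X \<and> \<Gamma> X \<^bold>1\<^bsub>L\<^esub> = cou L X) \<and>
     (\<forall>X Y b. \<Gamma> X (Y \<cdot>\<^bsub>L\<^esub> src L b) = \<Gamma> X (Y \<cdot>\<^bsub>L\<^esub> tgt L b))"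

definition drinfeld_cotwist :: "('k, 'b, 'l::ab_group_add) algebroid \<Rightarrow>
    ('l \<Rightarrow> 'l \<Rightarrow> 'b) \<Rightarrow> ('l \<Rightarrow> 'l \<Rightarrow> 'b) \<Rightarrow> ('k, 'b, 'l) algebroid" where
  "drinfeld_cotwist L \<Gamma> \<Gamma>inv = L\<lparr>amult := \<lambda>X Y.
     \<Sum>(x1, x2, x3)\<in>#sw3 L X. \<Sum>(y1, y2, y3)\<in>#sw3 L Y.
       src L (\<Gamma> x1 y1) \<cdot>\<^bsub>L\<^esub> tgt L (\<Gamma>inv x3 y3) \<cdot>\<^bsub>L\<^esub> (x2 \<cdot>\<^bsub>L\<^esub> y2)\<rparr>"

definition cotwist_mult :: "('k, 'b, 'l::ab_group_add) algebroid \<Rightarrow>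
    ('l \<Rightarrow> 'l \<Rightarrow> 'b) \<Rightarrow> 'l \<Rightarrow> 'l \<Rightarrow> 'l" where
  "cotwist_mult L \<Gamma> X Y =
     (\<Sum>(x1, x2)\<in>#sw L X. \<Sum>(y1, y2)\<in>#sw L Y.
      \<Sum>(xp, xm)\<in>#pm L x2. \<Sum>(yp, ym)\<in>#pm L y2.
        src L (\<Gamma> x1 y1) \<cdot>\<^bsub>L\<^esub> (xp \<cdot>\<^bsub>L\<^esub> yp) \<cdot>\<^bsub>L\<^esub> tgt L (\<Gamma> ym xm))"

definition cotwist_sharp :: "('k, 'b, 'l::ab_group_add) algebroid \<Rightarrow>
    ('l \<Rightarrow> 'l \<Rightarrow> 'b) \<Rightarrow> ('l \<times> 'l) multiset set \<Rightarrow> ('l \<times> 'l) multiset set" where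
  "cotwist_sharp L \<Gamma> = induced (dia L)
     (\<lambda>u. \<Sum>(X, Y)\<in>#u. \<Sum>(xp, xm)\<in>#pm L X.
        {#(xp \<cdot>\<^bsub>L\<^esub> tgt L (\<Gamma> xm y1), y2). (y1, y2) \<in># sw L Y#})"

text \<open>
  The domain of \<open>cotwist_sharp\<close> is the tensor product formed with the twisted product; this involves
  neither coproduct nor counit, so these may still be those of \<open>L\<close> there.
\<close>

definition cotwist :: "('k, 'b, 'l::ab_group_add) algebroid \<Rightarrow>
    ('l \<Rightarrow> 'l \<Rightarrow> 'b::ab_group_add) \<Rightarrow> ('k, 'b, 'l) algebroid" where
  "cotwist L \<Gamma> = L\<lparr>
     amult := cotwist_mult L \<Gamma>,
     base := (base L)\<lparr>amult := \<lambda>a b. \<Gamma> (src L a) (src L b)\<rparr>,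
     cop := \<lambda>X. the_inv_into (UNIV // dia (L\<lparr>amult := cotwist_mult L \<Gamma>\<rparr>)) (cotwist_sharp L \<Gamma>)
                  (cop L X),
     cou := \<lambda>X. \<Sum>(xp, xm)\<in>#pm L X. \<Gamma> xp xm\<rparr>"

definition Psi :: "('k, 'b::ab_group_add, 'l::ab_group_add) algebroid \<Rightarrow>
    ('l \<Rightarrow> 'l \<Rightarrow> 'b) \<Rightarrow> 'l \<Rightarrow> 'l" where
  "Psi L \<Gamma> X =
     (\<Sum>(x1, x2)\<in>#sw L X. \<Sum>(xp, xm)\<in>#pm L x2. tgt L (\<Gamma> xp xm) \<cdot>\<^bsub>L\<^esub> x1)"

definition Psi_inv :: "('k, 'b::ab_group_add, 'l::ab_group_add) algebroid \<Rightarrow>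
    ('l \<Rightarrow> 'l \<Rightarrow> 'b) \<Rightarrow> 'l \<Rightarrow> 'l" where
  "Psi_inv L \<Gamma>inv X =
     (\<Sum>(x1, x2)\<in>#sw L X. \<Sum>(xp, xm)\<in>#pm L x1. xp \<cdot>\<^bsub>L\<^esub> tgt L (\<Gamma>inv xm x2))"

end

theory Submission
  imports Defs
begin

text \<open>
  \<^bold>\<open>The idea.\<close>  Put \<open>\<phi>(X) = \<Gamma>(X\<^sub>+, X\<^sub>-)\<close>, the counit of the cotwist, so that \<open>\<Psi>(X) = t(\<phi>(X\<^sub>2)) X\<^sub>1\<close>.
  Three consequences of the cocycle identity carry the proof:

    \<^item> \<open>\<Gamma>(P Y\<^sub>+, Y\<^sub>-) = \<Gamma>\<^sup>-\<^sup>1(P, \<Psi>(Y))\<close> (\<open>P_G_eq\<close>);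

    \<^item> \<open>\<phi>(X\<^sub>+ Y\<^sub>+ t(\<Gamma>(Y\<^sub>-, X\<^sub>-))) = \<Gamma>\<^sup>-\<^sup>1(\<Psi>(X), \<Psi>(Y))\<close> (\<open>\<phi>_twisted\<close>);

    \<^item> \<open>\<Gamma>(X\<^sub>1\<^sub>+, s(\<Gamma>\<^sup>-\<^sup>1(X\<^sub>1\<^sub>-\<^sub>1, X\<^sub>2)) X\<^sub>1\<^sub>-\<^sub>2) = \<epsilon>(X)\<close> (\<open>S_N\<close>).

  The coring structure interacts with \<open>\<Psi>\<close> by \<open>\<Delta>(\<Psi>(X)) = X\<^sub>1 \<diamondop> \<Psi>(X\<^sub>2)\<close> (\<open>S_\<Psi>\<close>) and \<open>\<epsilon>(\<Psi>(X)) = \<phi>(X)\<close>.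
  In the product of the cotwist, \<open>s(\<Gamma>(X\<^sub>1, Y\<^sub>1))\<close> stands on the left as in the Drinfeld cotwist, and
  \<open>\<Psi>\<close> leaves it alone; the remaining factor yields a value \<open>\<phi>(X\<^sub>+ Y\<^sub>+ t(\<Gamma>(Y\<^sub>-, X\<^sub>-)))\<close> of \<open>\<phi>\<close>, which by
  the second identity is the \<open>\<Gamma>\<^sup>-\<^sup>1\<close>-factor of the product \<open>\<Psi>(X) *\<^sub>\<Gamma> \<Psi>(Y)\<close> of the Drinfeld cotwist.
  The first identity makes \<open>\<Psi>\<^sup>-\<^sup>1 \<circ> \<Psi>\<close> collapse, the third one \<open>\<Psi> \<circ> \<Psi>\<^sup>-\<^sup>1\<close>.

  For coproducts, \<open>f \<mapsto> (X \<diamondop> Y \<mapsto> X\<^sub>+ t(f(X\<^sub>-, Y\<^sub>1)) \<diamondop> Y\<^sub>2)\<close> turns convolution of \<open>B\<^sup>e\<close>-linear maps into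
  composition (in the opposite order), so \<open>\<Gamma>\<^sup>#\<close> is invertible, its inverse being formed with \<open>\<Gamma>\<^sup>-\<^sup>1\<close>.
  Therefore \<open>\<Delta>\<^sup>\<Gamma>(X) = \<Psi>\<^sup>-\<^sup>1(X\<^sub>1) \<diamondop> X\<^sub>2\<close>, and \<open>\<Psi> \<diamondop> \<Psi>\<close> maps this to \<open>X\<^sub>1 \<diamondop> \<Psi>(X\<^sub>2) = \<Delta>(\<Psi>(X))\<close>.

  \<^bold>\<open>The method.\<close>  Equations between elements of tensor products are always tested on balanced maps with
  values in an abelian group: sums \<open>f(X\<^sub>1, X\<^sub>2)\<close> over a representative of \<open>\<Delta>(X)\<close> and \<open>g(X\<^sub>+, X\<^sub>-)\<close> over a
  representative of \<open>X\<^sub>+ \<otimes> X\<^sub>-\<close>.  In this form Sweedler calculus, including iterated tensor products, is a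
  calculus of ordinary finite sums, and the proof obligations are that the summands are balanced.
\<close>

section \<open>A type of abelian groups containing all quotients of formal sums\<close>

text \<open>
  The quotient of the formal sums by \<open>E\<close> is an abelian group; the last clause supplies negatives.
\<close>

definition group_cong :: "('x multiset \<times> 'x multiset) set \<Rightarrow> bool" where
  "group_cong E \<longleftrightarrow> equiv UNIV E \<and> (\<forall>u v w. (u, v) \<in> E \<longrightarrow> (u + w, v + w) \<in> E) \<and>
     (\<forall>u. \<exists>v. (u + v, {#}) \<in> E)"

lemma group_cong_refl: "group_cong E \<Longrightarrow> (u, u) \<in> E"
  by (auto simp: group_cong_def equiv_def refl_on_def)

lemma group_cong_sym: "group_cong E \<Longrightarrow> (u, v) \<in> E \<Longrightarrow> (v, u) \<in> E"
  by (auto simp: group_cong_def equiv_def elim: symE)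

lemma group_cong_trans: "group_cong E \<Longrightarrow> (u, v) \<in> E \<Longrightarrow> (v, w) \<in> E \<Longrightarrow> (u, w) \<in> E"
  by (auto simp: group_cong_def equiv_def elim: transE)

lemma group_cong_plus:
  assumes "group_cong E" "(u, v) \<in> E" "(u', v') \<in> E"
  shows "(u + u', v + v') \<in> E"
  using assms by (metis group_cong_def group_cong_trans add.commute)

lemma group_cong_cancel:
  assumes E: "group_cong E" and "(u + w, v + w') \<in> E" "(w, w') \<in> E"
  shows "(u, v) \<in> E"
proof -
  obtain z where z: "(w + z, {#}) \<in> E" using E unfolding group_cong_def by blast
  have z': "(w' + z, {#}) \<in> E"
    using group_cong_trans[OF E group_cong_plus[OF E group_cong_sym[OF E assms(3)] group_cong_refl[OF E, of z]] z] .
  have 1: "(u + w + z, v + w' + z) \<in> E"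
    using group_cong_plus[OF E assms(2) group_cong_refl[OF E]] .
  have 2: "(u + w + z, u) \<in> E"
    using group_cong_plus[OF E group_cong_refl[OF E, of u] z] by (simp add: ac_simps)
  have 3: "(v + w' + z, v) \<in> E"
    using group_cong_plus[OF E group_cong_refl[OF E, of v] z'] by (simp add: ac_simps)
  show ?thesis
    using group_cong_trans[OF E group_cong_trans[OF E group_cong_sym[OF E 2] 1] 3] .
qed

definition quot_inverse ::
  "('a multiset \<times> 'a multiset) set \<Rightarrow> 'a multiset \<Rightarrow> 'a multiset" where
  "quot_inverse E u = (SOME v. (u + v, {#}) \<in> E)"

lemma quot_inverse: "group_cong E \<Longrightarrow> (u + quot_inverse E u, {#}) \<in> E"
  unfolding quot_inverse_def by (rule someI_ex) (auto simp: group_cong_def)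

text \<open>
  The group \<open>L \<diamondop> L\<close> depends on the algebroid \<open>L\<close> and is therefore not a type, but balanced maps into it
  should be covered by statements on maps into types of class \<open>ab_group_add\<close>.  So one type collects, as
  a direct product, the quotients by all congruences that yield groups.
\<close>

quotient_type 'x quot_group = "('x multiset \<times> 'x multiset) set \<Rightarrow> 'x multiset" /
  "\<lambda>F G. \<forall>E. group_cong E \<longrightarrow> (F E, G E) \<in> E"
  by (rule equivpI; rule reflpI sympI transpI; blast intro: group_cong_refl group_cong_sym group_cong_trans)

instantiation quot_group :: (type) ab_group_add
begin

lift_definition zero_quot_group :: "'a quot_group" is "\<lambda>_. {#}" .

lift_definition plus_quot_group :: "'a quot_group \<Rightarrow> 'a quot_group \<Rightarrow> 'a quot_group" is
  "\<lambda>F G E. F E + G E" by (auto intro: group_cong_plus)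

lift_definition uminus_quot_group :: "'a quot_group \<Rightarrow> 'a quot_group" is
  "\<lambda>F E. quot_inverse E (F E)"
proof -
  fix F G :: "('a multiset \<times> 'a multiset) set \<Rightarrow> 'a multiset"
    and E :: "('a multiset \<times> 'a multiset) set"
  assume FG: "\<And>E. group_cong E \<Longrightarrow> (F E, G E) \<in> E" and E: "group_cong E"
  have "(quot_inverse E (F E) + F E, quot_inverse E (G E) + G E) \<in> E"
    using quot_inverse[OF E, of "F E"] quot_inverse[OF E, of "G E"] E
    by (metis add.commute group_cong_sym group_cong_trans)
  then show "(quot_inverse E (F E), quot_inverse E (G E)) \<in> E"
    using group_cong_cancel[OF E] FG E by blast
qed

definition minus_quot_group :: "'a quot_group \<Rightarrow> 'a quot_group \<Rightarrow> 'a quot_group" where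
  "minus_quot_group x y = x + - y"

instance
proof
  fix a b c :: "'a quot_group"
  show "a + b + c = a + (b + c)"
    by transfer (auto simp: add.assoc group_cong_refl)
  show "a + b = b + a"
    by transfer (auto simp: add.commute group_cong_refl)
  show "0 + a = a"
    by transfer (auto simp: group_cong_refl)
  show "- a + a = 0"
    by transfer (metis add.commute quot_inverse)
qed (simp add: minus_quot_group_def)

end

text \<open>
  The embedding of the quotient by \<open>E\<close> as one factor of the product.
\<close>

lift_definition quot_class :: "('x multiset \<times> 'x multiset) set \<Rightarrow> 'x multiset \<Rightarrow> 'x quot_group" is
  "\<lambda>E u E'. if E' = E then u else {#}" .

lemma quot_class_eq_iff: "group_cong E \<Longrightarrow> quot_class E u = quot_class E v \<longleftrightarrow> (u, v) \<in> E"
  by transfer (auto simp: group_cong_refl)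

lemma quot_class_add: "quot_class E (u + v) = quot_class E u + quot_class E v"
  by transfer (auto simp: group_cong_refl)

lemma quot_class_empty: "quot_class E {#} = 0"
  by transfer (auto simp: group_cong_refl)

lemma quot_class_sum: "quot_class E u = (\<Sum>x\<in>#u. quot_class E {#x#})"
proof (induction u)
  case (add x u)
  then show ?case using quot_class_add[of E "{#x#}" u] by simp
qed (simp add: quot_class_empty)


text \<open>
  On classes, \<open>induced\<close> is what the representatives say as soon as the congruences are respected.
\<close>

lemma induced_class:
  assumes "equiv UNIV E" "equiv UNIV E'" and cong: "\<And>u v. (u, v) \<in> E \<Longrightarrow> (\<phi> u, \<phi> v) \<in> E'"
  shows "induced E' \<phi> (E `` {u}) = E' `` {\<phi> u}"
proof
  show "induced E' \<phi> (E `` {u}) \<subseteq> E' `` {\<phi> u}"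
    using assms(2) cong by (auto simp: induced_def equiv_def elim: transE)
  show "E' `` {\<phi> u} \<subseteq> induced E' \<phi> (E `` {u})"
    using assms(1) by (auto simp: induced_def equiv_def refl_on_def)
qed

section \<open>Balanced maps and tensor products\<close>

definition balanced ::
  "('b \<Rightarrow> 'm \<Rightarrow> 'm) \<Rightarrow> ('b \<Rightarrow> 'n \<Rightarrow> 'n) \<Rightarrow> ('m::ab_group_add \<Rightarrow> 'n::ab_group_add \<Rightarrow> 'g::ab_group_add) \<Rightarrow> bool" where
  "balanced \<alpha> \<beta> f \<longleftrightarrow> (\<forall>x x' y. f (x + x') y = f x y + f x' y) \<and>
     (\<forall>x y y'. f x (y + y') = f x y + f x y') \<and> (\<forall>b x y. f (\<alpha> b x) y = f x (\<beta> b y))"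

lemma balancedI:
  assumes "\<And>x x' y. f (x + x') y = f x y + f x' y" "\<And>x y y'. f x (y + y') = f x y + f x y'"
    "\<And>b x y. f (\<alpha> b x) y = f x (\<beta> b y)"
  shows "balanced \<alpha> \<beta> f"
  using assms by (simp add: balanced_def)

lemma additive_zero:
  fixes h :: "'a::ab_group_add \<Rightarrow> 'g::ab_group_add"
  assumes "\<And>x y. h (x + y) = h x + h y"
  shows "h 0 = 0"
  using assms[of 0 0] by simp

lemma balanced_zero:
  assumes "balanced \<alpha> \<beta> f" shows "f 0 y = 0" "f x 0 = 0"
  using assms additive_zero[of "\<lambda>x. f x y"] additive_zero[of "f x"] by (auto simp: balanced_def)

abbreviation tcong :: "('b \<Rightarrow> 'l \<Rightarrow> 'l::ab_group_add) \<Rightarrow> ('b \<Rightarrow> 'l \<Rightarrow> 'l) \<Rightarrow>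
    (('l \<times> 'l) multiset \<times> ('l \<times> 'l) multiset) set" where
  "tcong \<alpha> \<beta> \<equiv> tensor_cong (action_module \<alpha>) (action_module \<beta>)"

lemma balanced_sum_cong:
  assumes "(u, v) \<in> tcong \<alpha> \<beta>" and f: "balanced \<alpha> \<beta> f"
  shows "(\<Sum>(x, y)\<in>#u. f x y) = (\<Sum>(x, y)\<in>#v. f x y)"
  using assms(1)
proof induction
  case (step u v)
  then show ?case
    using f balanced_zero[OF f]
    by (cases rule: tensor_step.cases) (auto simp: action_module_def balanced_def)
qed auto

lemma formal_cong_plus2:
  assumes "(u, v) \<in> formal_cong R" "(u', v') \<in> formal_cong R"
  shows "(u + u', v + v') \<in> formal_cong R"
  using formal_cong.plus[OF assms(1), of u'] formal_cong.plus[OF assms(2), of v]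
  by (metis add.commute formal_cong.trans)

text \<open>
  Negatives exist because \<open>(x, y)\<close> and \<open>(- x, y)\<close> add up to \<open>(0, y)\<close>.
\<close>

lemma group_cong_tcong: "group_cong (tcong \<alpha> \<beta>)"
proof -
  let ?E = "tcong \<alpha> \<beta>"
  have neg: "({#(x, y)#} + {#(- x, y)#}, {#}) \<in> ?E" for x y
  proof -
    have "({#(x + - x, y)#}, {#(x, y), (- x, y)#}) \<in> ?E"
      using tensor_step.add_left[of x "action_module \<alpha>" "- x" y "action_module \<beta>"]
      by (intro formal_cong.step) (simp add: action_module_def)
    moreover have "({#(x + - x, y)#}, {#}) \<in> ?E"
      using tensor_step.zero_left[of y "action_module \<beta>" "action_module \<alpha>"]
      by (intro formal_cong.step) (simp add: action_module_def)
    ultimately have "({#(x, y), (- x, y)#}, {#}) \<in> ?E"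
      by (auto intro: formal_cong.sym formal_cong.trans)
    then show ?thesis by (simp add: add_mset_commute)
  qed
  have inv: "\<exists>v. (u + v, {#}) \<in> ?E" for u
  proof (induction u)
    case empty
    then show ?case by (auto intro!: exI[of _ "{#}"] formal_cong.refl)
  next
    case (add z u)
    then obtain v where "(u + v, {#}) \<in> ?E" by auto
    from formal_cong_plus2[OF this neg[of "fst z" "snd z"]]
    show ?case by (intro exI[of _ "v + {#(- fst z, snd z)#}"]) (simp add: ac_simps)
  qed
  have "equiv UNIV ?E"
    by (intro equivI refl_onI symI transI)
      (auto intro: formal_cong.refl formal_cong.sym formal_cong.trans)
  then show ?thesis using inv by (auto simp: group_cong_def intro: formal_cong.plus)
qed

text \<open>
  The universal balanced map.  Testing formal sums on this one map decides their congruence (\<open>tcong_iff\<close>).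
\<close>

definition tensor_class :: "('b \<Rightarrow> 'l \<Rightarrow> 'l::ab_group_add) \<Rightarrow> ('b \<Rightarrow> 'l \<Rightarrow> 'l) \<Rightarrow> 'l \<Rightarrow> 'l \<Rightarrow> ('l \<times> 'l) quot_group" where
  "tensor_class \<alpha> \<beta> x y = quot_class (tcong \<alpha> \<beta>) {#(x, y)#}"

lemma tcong_iff: "(u, v) \<in> tcong \<alpha> \<beta> \<longleftrightarrow> (\<Sum>(x, y)\<in>#u. tensor_class \<alpha> \<beta> x y) = (\<Sum>(x, y)\<in>#v. tensor_class \<alpha> \<beta> x y)"
proof -
  have "(\<Sum>(x, y)\<in>#w. tensor_class \<alpha> \<beta> x y) = quot_class (tcong \<alpha> \<beta>) w" for w
    by (subst quot_class_sum) (auto simp: tensor_class_def intro!: arg_cong[of _ _ sum_mset] image_mset_cong)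
  then show ?thesis by (simp add: quot_class_eq_iff[OF group_cong_tcong])
qed

lemma balanced_tensor_class: "balanced \<alpha> \<beta> (tensor_class \<alpha> \<beta>)"
proof -
  note iff = quot_class_eq_iff[OF group_cong_tcong]
  have add: "quot_class E {#p#} + quot_class E {#q#} = quot_class E {#p, q#}" for E p and q :: "'l \<times> 'l"
    using quot_class_add[of E "{#p#}" "{#q#}"] by (simp add: add.commute add_mset_commute)
  let ?M = "action_module \<alpha>" and ?N = "action_module \<beta>"
  show ?thesis
    unfolding balanced_def tensor_class_def add iff
    using tensor_step.add_left[of _ ?M _ _ ?N] tensor_step.add_right[of _ ?M _ ?N]
      tensor_step.balanced[of _ ?M _ ?N]
    by (auto simp: action_module_def intro!: formal_cong.step)
qed

section \<open>Sweedler sums over coproducts\<close>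

text \<open>
  \<open>cop_sum L X f\<close> is \<open>f(X\<^sub>1, X\<^sub>2)\<close> and \<open>pm_sum L X f\<close> is \<open>f(X\<^sub>+, X\<^sub>-)\<close> in Sweedler notation.
\<close>

definition cop_sum :: "('k, 'b, 'l) algebroid \<Rightarrow> 'l \<Rightarrow> ('l \<Rightarrow> 'l \<Rightarrow> 'g::comm_monoid_add) \<Rightarrow> 'g" where
  "cop_sum L X f = (\<Sum>(x, y)\<in>#sw L X. f x y)"

definition pm_sum ::
  "('k, 'b, 'l::ab_group_add) algebroid \<Rightarrow> 'l \<Rightarrow> ('l \<Rightarrow> 'l \<Rightarrow> 'g::comm_monoid_add) \<Rightarrow> 'g" where
  "pm_sum L X f = (\<Sum>(x, y)\<in>#pm L X. f x y)"

lemma sum_mset_sum_mset: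
  "(\<Sum>z\<in>#(\<Sum>x\<in>#u. m x). f z) = (\<Sum>x\<in>#u. \<Sum>z\<in>#m x. f z)"
  by (induction u) auto

lemma sum_mset_additive:
  fixes h :: "'a::ab_group_add \<Rightarrow> 'g::ab_group_add"
  assumes "\<And>x y. h (x + y) = h x + h y"
  shows "h (\<Sum>x\<in>#u. f x) = (\<Sum>x\<in>#u. h (f x))"
  using additive_zero[of h] assms by (induction u) auto

lemma cop_sum_distrib: "cop_sum L X (\<lambda>x y. f x y + g x y) = cop_sum L X f + cop_sum L X g"
  by (simp add: cop_sum_def case_prod_unfold sum_mset.distrib)

lemma pm_sum_distrib: "pm_sum L X (\<lambda>x y. f x y + g x y) = pm_sum L X f + pm_sum L X g"
  by (simp add: pm_sum_def case_prod_unfold sum_mset.distrib)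

lemma cop_sum_additive:
  fixes h :: "'a::ab_group_add \<Rightarrow> 'g::ab_group_add"
  assumes "\<And>x y. h (x + y) = h x + h y"
  shows "h (cop_sum L X f) = cop_sum L X (\<lambda>x y. h (f x y))"
  using sum_mset_additive[of h, OF assms] by (simp add: cop_sum_def case_prod_unfold)

lemma pm_sum_additive:
  fixes h :: "'a::ab_group_add \<Rightarrow> 'g::ab_group_add"
  assumes "\<And>x y. h (x + y) = h x + h y"
  shows "h (pm_sum L X f) = pm_sum L X (\<lambda>x y. h (f x y))"
  using sum_mset_additive[of h, OF assms] by (simp add: pm_sum_def case_prod_unfold)

lemma cop_sum_swap:
  "cop_sum L X (\<lambda>x y. cop_sum L Y (f x y)) = cop_sum L Y (\<lambda>y z. cop_sum L X (\<lambda>w x. f w x y z))"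
  unfolding cop_sum_def case_prod_unfold by (rule sum_mset.swap)

lemma pm_sum_swap:
  "pm_sum L X (\<lambda>x y. pm_sum L Y (f x y)) = pm_sum L Y (\<lambda>y z. pm_sum L X (\<lambda>w x. f w x y z))"
  unfolding pm_sum_def case_prod_unfold by (rule sum_mset.swap)

lemma cop_pm_sum_swap:
  "cop_sum L X (\<lambda>x y. pm_sum L Y (f x y)) = pm_sum L Y (\<lambda>y z. cop_sum L X (\<lambda>w x. f w x y z))"
  unfolding pm_sum_def cop_sum_def case_prod_unfold by (rule sum_mset.swap)

lemma balanced_cop_sum:
  "(\<And>x y. balanced \<alpha> \<beta> (\<lambda>p q. f p q x y)) \<Longrightarrow> balanced \<alpha> \<beta> (\<lambda>p q. cop_sum L X (\<lambda>x y. f p q x y))"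
  by (simp add: balanced_def cop_sum_def case_prod_unfold sum_mset.distrib)

lemma balanced_pm_sum:
  "(\<And>x y. balanced \<alpha> \<beta> (\<lambda>p q. f p q x y)) \<Longrightarrow> balanced \<alpha> \<beta> (\<lambda>p q. pm_sum L X (\<lambda>x y. f p q x y))"
  by (simp add: balanced_def pm_sum_def case_prod_unfold sum_mset.distrib)

lemma cop_sum_cong: "(\<And>x y. f x y = g x y) \<Longrightarrow> cop_sum L X f = cop_sum L X g"
  by (simp add: cop_sum_def)

lemma pm_sum_cong: "(\<And>x y. f x y = g x y) \<Longrightarrow> pm_sum L X f = pm_sum L X g"
  by (simp add: pm_sum_def)

lemma pm_cop_sum_swap:
  "pm_sum L X (\<lambda>x y. cop_sum L Y (f x y)) = cop_sum L Y (\<lambda>y z. pm_sum L X (\<lambda>w x. f w x y z))"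
  by (rule cop_pm_sum_swap[symmetric])

text \<open>
  Within the locale, \<open>S\<close> and \<open>P\<close> are the two Sweedler sums; \<open>dbal f\<close> means that \<open>f\<close> factors through
  \<open>L \<diamondop> L\<close>, and \<open>obal g\<close> that \<open>g\<close> factors through the tensor product of \<open>L\<close> with itself over the opposite
  of the base.  The rules that compute \<open>S\<close> from another representative of \<open>\<Delta>(X)\<close> have a \<open>dbal\<close> premise, because
  only then the sum does not depend on the representative.
\<close>

locale bialgebroid =
  fixes L :: "('k::field, 'b::ab_group_add, 'l::ab_group_add) algebroid" (structure)
  assumes bialgebroid: "left_bialgebroid L"
begin

abbreviation s where "s \<equiv> src L"
abbreviation t where "t \<equiv> tgt L"
abbreviation e where "e \<equiv> cou L"
abbreviation base_mult (infixl "\<star>" 70) where "a \<star> b \<equiv> a \<cdot>\<^bsub>base L\<^esub> b"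
abbreviation S where "S \<equiv> cop_sum L"
abbreviation P where "P \<equiv> pm_sum L"
abbreviation dbal where "dbal \<equiv> balanced (\<lambda>b X. t b \<cdot> X) (\<lambda>b X. s b \<cdot> X)"
abbreviation obal where "obal \<equiv> balanced (\<lambda>b X. X \<cdot> t b) (\<lambda>b X. t b \<cdot> X)"

lemma mult [simp]:
  "(x + y) \<cdot> z = x \<cdot> z + y \<cdot> z" "x \<cdot> (y + z) = x \<cdot> y + x \<cdot> z"
  "(x \<cdot> y) \<cdot> z = x \<cdot> (y \<cdot> z)" "\<^bold>1 \<cdot> x = x" "x \<cdot> \<^bold>1 = x"
  using bialgebroid
  by (simp_all add: left_bialgebroid_def unital_algebra_def Vector_Spaces.linear_def module_hom_def module_hom_axioms_def)

lemma base_mult [simp]: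
  "(a + b) \<star> c = a \<star> c + b \<star> c" "a \<star> (b + c) = a \<star> b + a \<star> c"
  "(a \<star> b) \<star> c = a \<star> (b \<star> c)" "\<^bold>1\<^bsub>base L\<^esub> \<star> a = a" "a \<star> \<^bold>1\<^bsub>base L\<^esub> = a"
  using bialgebroid
  by (simp_all add: left_bialgebroid_def unital_algebra_def Vector_Spaces.linear_def module_hom_def module_hom_axioms_def)

lemma src [simp]: "s (a + b) = s a + s b" "s (a \<star> b) = s a \<cdot> s b" "s \<^bold>1\<^bsub>base L\<^esub> = \<^bold>1"
  using bialgebroid
  by (simp_all add: left_bialgebroid_def algebra_map_def Vector_Spaces.linear_def module_hom_def module_hom_axioms_def)

lemma tgt [simp]: "t (a + b) = t a + t b" "t (a \<star> b) = t b \<cdot> t a" "t \<^bold>1\<^bsub>base L\<^esub> = \<^bold>1"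
  using bialgebroid
  by (simp_all add: left_bialgebroid_def algebra_map_def opposite_def Vector_Spaces.linear_def module_hom_def
      module_hom_axioms_def)

lemma tgt_src: "t b \<cdot> s a = s a \<cdot> t b"
  using bialgebroid by (simp add: left_bialgebroid_def)

lemma tgt_src_left: "t b \<cdot> (s a \<cdot> x) = s a \<cdot> (t b \<cdot> x)"
  using tgt_src mult(3) by metis

lemma cou_act: "e (s a \<cdot> (t b \<cdot> X)) = a \<star> (e X \<star> b)"
  using bialgebroid by (simp add: left_bialgebroid_def)

lemma cou [simp]:
  "e (X + Y) = e X + e Y" "e (s a \<cdot> X) = a \<star> e X" "e (t b \<cdot> X) = e X \<star> b" "e \<^bold>1 = \<^bold>1\<^bsub>base L\<^esub>"
  "e (s b) = b" "e (t b) = b"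
  using bialgebroid cou_act[of a "\<^bold>1\<^bsub>base L\<^esub>" X] cou_act[of "\<^bold>1\<^bsub>base L\<^esub>" b X]
    cou_act[of b "\<^bold>1\<^bsub>base L\<^esub>" "\<^bold>1"] cou_act[of "\<^bold>1\<^bsub>base L\<^esub>" b "\<^bold>1"]
  by (simp_all add: left_bialgebroid_def)

lemma cou_mult: "e (X \<cdot> s (e Y)) = e (X \<cdot> Y)" "e (X \<cdot> t (e Y)) = e (X \<cdot> Y)"
  using bialgebroid by (simp_all add: left_bialgebroid_def)

lemma cou_src_tgt: "e (X \<cdot> t b) = e (X \<cdot> s b)"
  using cou_mult[of X "s b"] by simp

lemma mult_additive_sums:
  "X \<cdot> S Y f = S Y (\<lambda>x y. X \<cdot> f x y)" "S Y f \<cdot> X = S Y (\<lambda>x y. f x y \<cdot> X)"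
  "X \<cdot> P Y f = P Y (\<lambda>x y. X \<cdot> f x y)" "P Y f \<cdot> X = P Y (\<lambda>x y. f x y \<cdot> X)"
  "a \<star> S Y g = S Y (\<lambda>x y. a \<star> g x y)" "S Y g \<star> a = S Y (\<lambda>x y. g x y \<star> a)"
  "a \<star> P Y g = P Y (\<lambda>x y. a \<star> g x y)" "P Y g \<star> a = P Y (\<lambda>x y. g x y \<star> a)"
  "s (S Y g) = S Y (\<lambda>x y. s (g x y))" "t (S Y g) = S Y (\<lambda>x y. t (g x y))"
  "s (P Y g) = P Y (\<lambda>x y. s (g x y))" "t (P Y g) = P Y (\<lambda>x y. t (g x y))"
  using cop_sum_additive[of "\<lambda>x. X \<cdot> x" L Y f] cop_sum_additive[of "\<lambda>x. x \<cdot> X" L Y f]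
    pm_sum_additive[of "\<lambda>x. X \<cdot> x" L Y f] pm_sum_additive[of "\<lambda>x. x \<cdot> X" L Y f]
    cop_sum_additive[of "\<lambda>x. a \<star> x" L Y g] cop_sum_additive[of "\<lambda>x. x \<star> a" L Y g]
    pm_sum_additive[of "\<lambda>x. a \<star> x" L Y g] pm_sum_additive[of "\<lambda>x. x \<star> a" L Y g]
    cop_sum_additive[of s L Y g] cop_sum_additive[of t L Y g]
    pm_sum_additive[of s L Y g] pm_sum_additive[of t L Y g]
  by simp_all

lemma sw_in: "sw L X \<in> cop L X"
proof -
  have "cop L X \<in> UNIV // dia L" using bialgebroid by (simp add: left_bialgebroid_def)
  then have "\<exists>u. u \<in> cop L X" by (auto simp: quotient_def intro: formal_cong.refl)
  then show ?thesis unfolding rep_def by (rule someI_ex)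
qed

lemma cop_eq_class: "u \<in> cop L X \<Longrightarrow> cop L X = dia L `` {u}"
proof -
  assume u: "u \<in> cop L X"
  have "cop L X \<in> UNIV // dia L" using bialgebroid by (simp add: left_bialgebroid_def)
  then obtain v where v: "cop L X = dia L `` {v}" by (auto simp: quotient_def)
  have "equiv UNIV (dia L)" using group_cong_tcong by (auto simp: group_cong_def)
  then show ?thesis using equiv_class_eq[of UNIV "dia L" v u] u v by auto
qed

lemma S_eval:
  assumes "u \<in> cop L X" "dbal f"
  shows "S X f = (\<Sum>(x, y)\<in>#u. f x y)"
proof -
  have "(sw L X, u) \<in> dia L" using cop_eq_class[OF assms(1)] sw_in[of X] by (auto intro: formal_cong.sym)
  from balanced_sum_cong[OF this assms(2)] show ?thesis by (simp add: cop_sum_def)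
qed

lemma S_add:
  assumes "dbal f"
  shows "S (X + Y) f = S X f + S Y f"
proof -
  have "sw L X + sw L Y \<in> cop L (X + Y)"
    using bialgebroid sw_in by (simp add: left_bialgebroid_def)
  from S_eval[OF this assms] show ?thesis by (simp add: cop_sum_def)
qed

lemma cop_act:
  "u \<in> cop L X \<Longrightarrow> {#(s a \<cdot> x1, t b \<cdot> x2). (x1, x2) \<in># u#} \<in> cop L (s a \<cdot> (t b \<cdot> X))"
  using bialgebroid by (simp add: left_bialgebroid_def)

lemma S_act:
  assumes "dbal f"
  shows "S (s a \<cdot> (t b \<cdot> X)) f = S X (\<lambda>x y. f (s a \<cdot> x) (t b \<cdot> y))"
  using S_eval[OF cop_act[OF sw_in] assms]
  by (simp add: cop_sum_def case_prod_unfold image_mset.compositionality comp_def)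

text \<open>
  The representative \<open>v\<close> of \<open>\<Delta>(Y)\<close> is arbitrary: for fixed components of \<open>X\<close> the summand is in general
  not balanced in the components of \<open>Y\<close>, so that a representative cannot be exchanged afterwards.
  The rules for right multiplication by \<open>s a\<close> and \<open>t a\<close> come from \<open>\<Delta>(s(a)) = s(a) \<diamondop> 1\<close> and
  \<open>\<Delta>(t(a)) = 1 \<diamondop> t(a)\<close> in this way.
\<close>

lemma S_mult_eval:
  assumes "v \<in> cop L Y" "dbal f"
  shows "S (X \<cdot> Y) f = S X (\<lambda>x y. \<Sum>(z, w)\<in>#v. f (x \<cdot> z) (y \<cdot> w))"
proof -
  have "(\<Sum>(x1, x2)\<in>#sw L X. {#(x1 \<cdot> y1, x2 \<cdot> y2). (y1, y2) \<in># v#}) \<in> cop L (X \<cdot> Y)"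
    using bialgebroid sw_in assms(1) by (simp add: left_bialgebroid_def)
  from S_eval[OF this assms(2)] show ?thesis
    by (simp add: cop_sum_def case_prod_unfold image_mset.compositionality comp_def sum_mset_sum_mset)
qed

lemma S_mult: "dbal f \<Longrightarrow> S (X \<cdot> Y) f = S X (\<lambda>x y. S Y (\<lambda>z w. f (x \<cdot> z) (y \<cdot> w)))"
  using S_mult_eval[OF sw_in[of Y], of f X] by (simp add: cop_sum_def)

lemma S_one:
  assumes "dbal f" shows "S \<^bold>1 f = f \<^bold>1 \<^bold>1"
proof -
  have "{#(\<^bold>1, \<^bold>1)#} \<in> cop L \<^bold>1" using bialgebroid by (simp add: left_bialgebroid_def)
  from S_eval[OF this assms] show ?thesis by simp
qed

lemma S_takeuchi:
  assumes "dbal f"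
  shows "S X (\<lambda>x y. f (x \<cdot> t b) y) = S X (\<lambda>x y. f x (y \<cdot> s b))"
proof -
  have "({#(x1 \<cdot> t b, x2). (x1, x2) \<in># sw L X#}, {#(x1, x2 \<cdot> s b). (x1, x2) \<in># sw L X#}) \<in> dia L"
    using bialgebroid sw_in[of X] by (simp add: left_bialgebroid_def)
  from balanced_sum_cong[OF this assms] show ?thesis
    by (simp add: cop_sum_def case_prod_unfold image_mset.compositionality comp_def)
qed

lemma cop_src_tgt: "{#(s a, t b)#} \<in> cop L (s a \<cdot> t b)"
proof -
  have "{#(\<^bold>1, \<^bold>1)#} \<in> cop L \<^bold>1" using bialgebroid by (simp add: left_bialgebroid_def)
  from cop_act[OF this, of a b] show ?thesis by simp
qed

lemma
  assumes "dbal f"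
  shows S_src_left: "S (s a \<cdot> X) f = S X (\<lambda>x y. f (s a \<cdot> x) y)"
    and S_tgt_left: "S (t a \<cdot> X) f = S X (\<lambda>x y. f x (t a \<cdot> y))"
    and S_src: "S (s a) f = f (s a) \<^bold>1"
    and S_tgt: "S (t a) f = f \<^bold>1 (t a)"
    and S_src_right: "S (X \<cdot> s a) f = S X (\<lambda>x y. f (x \<cdot> s a) y)"
    and S_tgt_right: "S (X \<cdot> t a) f = S X (\<lambda>x y. f x (y \<cdot> t a))"
  using S_act[OF assms, of a "\<^bold>1\<^bsub>base L\<^esub>" X] S_act[OF assms, of "\<^bold>1\<^bsub>base L\<^esub>" a X]
    S_eval[OF cop_src_tgt[of a "\<^bold>1\<^bsub>base L\<^esub>"] assms] S_eval[OF cop_src_tgt[of "\<^bold>1\<^bsub>base L\<^esub>" a] assms]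
    S_mult_eval[OF cop_src_tgt[of a "\<^bold>1\<^bsub>base L\<^esub>"] assms] S_mult_eval[OF cop_src_tgt[of "\<^bold>1\<^bsub>base L\<^esub>" a] assms]
  by simp_all

lemma S_counit_left:
  assumes "\<And>x y. h (x + y) = h x + (h y :: 'g::ab_group_add)"
  shows "S X (\<lambda>x y. h (s (e x) \<cdot> y)) = h X"
  using cop_sum_additive[of h L X "\<lambda>x y. s (e x) \<cdot> y"] assms bialgebroid
  by (simp add: left_bialgebroid_def cop_sum_def)

lemma S_counit_right:
  assumes "\<And>x y. h (x + y) = h x + (h y :: 'g::ab_group_add)"
  shows "S X (\<lambda>x y. h (t (e y) \<cdot> x)) = h X"
  using cop_sum_additive[of h L X "\<lambda>x y. t (e y) \<cdot> x"] assms bialgebroid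
  by (simp add: left_bialgebroid_def cop_sum_def)

lemma S_coassoc:
  fixes F :: "'l \<Rightarrow> 'l \<Rightarrow> 'l \<Rightarrow> 'g::ab_group_add"
  assumes 1: "\<And>z. dbal (\<lambda>x y. F x y z)" and 2: "\<And>x. dbal (\<lambda>y z. F x y z)"
  shows "S X (\<lambda>w z. S w (\<lambda>x y. F x y z)) = S X (\<lambda>x w. S w (\<lambda>y z. F x y z))"
proof -
  have "(\<Sum>(x, y, z)\<in>#u. F x y z) = (\<Sum>(x, y, z)\<in>#v. F x y z)"
    if "(u, v) \<in> formal_cong (dia3_step L)" for u v
    using that
  proof induction
    case (step u v)
    then show ?case
      using 1 2 balanced_zero[OF 1] balanced_zero[OF 2]
      by (cases rule: dia3_step.cases) (auto simp: balanced_def)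
  qed auto
  from this[of "\<Sum>(x', x3)\<in>#sw L X. {#(x1, x2, x3). (x1, x2) \<in># sw L x'#}" "sw3 L X"]
  have "(\<Sum>(x, y, z)\<in>#(\<Sum>(x', x3)\<in>#sw L X. {#(x1, x2, x3). (x1, x2) \<in># sw L x'#}). F x y z) =
      (\<Sum>(x, y, z)\<in>#sw3 L X. F x y z)"
    using bialgebroid by (simp add: left_bialgebroid_def)
  then show ?thesis
    by (simp add: cop_sum_def case_prod_unfold sw3_def image_mset.compositionality comp_def sum_mset_sum_mset)
qed

lemma Be_linear_simps:
  assumes "Be_linear L f"
  shows "f (X + X') Y = f X Y + f X' Y" "f X (Y + Y') = f X Y + f X Y'"
    "f (s a \<cdot> X) Y = a \<star> f X Y" "f (t a \<cdot> X) Y = f X Y \<star> a"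
    "f (s a) Y = a \<star> f \<^bold>1 Y" "f (t a) Y = f \<^bold>1 Y \<star> a"
    "f (X \<cdot> s a) Y = f X (s a \<cdot> Y)" "f (X \<cdot> t a) Y = f X (t a \<cdot> Y)"
    "f (Z \<cdot> (X \<cdot> s a)) Y = f (Z \<cdot> X) (s a \<cdot> Y)" "f (Z \<cdot> (X \<cdot> t a)) Y = f (Z \<cdot> X) (t a \<cdot> Y)"
proof -
  have l: "f (s a \<cdot> (t b \<cdot> X)) Y = a \<star> (f X Y \<star> b)" for a b X Y
    using assms by (simp add: Be_linear_def)
  have r: "f (X \<cdot> (s a \<cdot> t b)) Y = f X (s a \<cdot> (t b \<cdot> Y))" for a b X Y
    using assms by (simp add: Be_linear_def)
  show "f (X + X') Y = f X Y + f X' Y" "f X (Y + Y') = f X Y + f X Y'"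
    using assms by (simp_all add: Be_linear_def)
  show "f (s a \<cdot> X) Y = a \<star> f X Y" "f (t a \<cdot> X) Y = f X Y \<star> a"
    "f (s a) Y = a \<star> f \<^bold>1 Y" "f (t a) Y = f \<^bold>1 Y \<star> a"
    using l[of a "\<^bold>1\<^bsub>base L\<^esub>"] l[of "\<^bold>1\<^bsub>base L\<^esub>" a]
      l[of a "\<^bold>1\<^bsub>base L\<^esub>" "\<^bold>1"] l[of "\<^bold>1\<^bsub>base L\<^esub>" a "\<^bold>1"] by simp_all
  show "f (X \<cdot> s a) Y = f X (s a \<cdot> Y)" "f (X \<cdot> t a) Y = f X (t a \<cdot> Y)"
    "f (Z \<cdot> (X \<cdot> s a)) Y = f (Z \<cdot> X) (s a \<cdot> Y)" "f (Z \<cdot> (X \<cdot> t a)) Y = f (Z \<cdot> X) (t a \<cdot> Y)"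
    using r[of X a "\<^bold>1\<^bsub>base L\<^esub>"] r[of X "\<^bold>1\<^bsub>base L\<^esub>" a]
      r[of "Z \<cdot> X" a "\<^bold>1\<^bsub>base L\<^esub>"] r[of "Z \<cdot> X" "\<^bold>1\<^bsub>base L\<^esub>" a] by simp_all
qed

lemma Be_linear_sums:
  assumes "Be_linear L f"
  shows "f (S X g) Y = S X (\<lambda>x y. f (g x y) Y)" "f Y (S X g) = S X (\<lambda>x y. f Y (g x y))"
    "f (P X g) Y = P X (\<lambda>x y. f (g x y) Y)" "f Y (P X g) = P X (\<lambda>x y. f Y (g x y))"
  using cop_sum_additive[of "\<lambda>x. f x Y" L X g] cop_sum_additive[of "f Y" L X g]
    pm_sum_additive[of "\<lambda>x. f x Y" L X g] pm_sum_additive[of "f Y" L X g]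
  by (simp_all add: Be_linear_simps[OF assms])

section \<open>Sums over two coproducts\<close>

definition S2 :: "'l \<Rightarrow> 'l \<Rightarrow> ('l \<Rightarrow> 'l \<Rightarrow> 'l \<Rightarrow> 'l \<Rightarrow> 'g::ab_group_add) \<Rightarrow> 'g" where
  "S2 X Y f = S Y (\<lambda>y y'. S X (\<lambda>x x'. f x y x' y'))"

text \<open>
  For fixed components of \<open>X\<close>, a summand such as \<open>\<Gamma>(x, y) \<star> \<Gamma>\<^sup>-\<^sup>1(x', y')\<close> is not balanced in \<open>y\<close> and \<open>y'\<close>:
  moving \<open>b\<close> from one to the other shifts it through \<open>x\<close> and \<open>x'\<close>.  The last two clauses describe
  this shift, and the Takeuchi condition on \<open>\<Delta>(X)\<close> absorbs it after summation (\<open>dbal2_S\<close>).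
\<close>

definition dbal2 :: "('l \<Rightarrow> 'l \<Rightarrow> 'l \<Rightarrow> 'l \<Rightarrow> 'g::ab_group_add) \<Rightarrow> bool" where
  "dbal2 f \<longleftrightarrow> (\<forall>y y'. dbal (\<lambda>x x'. f x y x' y')) \<and>
     (\<forall>x x' y z y'. f x (y + z) x' y' = f x y x' y' + f x z x' y') \<and>
     (\<forall>x x' y z y'. f x y x' (y' + z) = f x y x' y' + f x y x' z) \<and>
     (\<forall>x x' y y' b. f x (t b \<cdot> y) x' y' = f (x \<cdot> t b) y x' y') \<and>
     (\<forall>x x' y y' b. f x y x' (s b \<cdot> y') = f x y (x' \<cdot> s b) y')"

lemma S2_swap: "S2 X Y f = S X (\<lambda>x x'. S Y (\<lambda>y y'. f x y x' y'))"
  unfolding S2_def by (rule cop_sum_swap)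

lemma dbal2_left: "dbal2 f \<Longrightarrow> dbal (\<lambda>x x'. f x y x' y')"
  by (simp add: dbal2_def)

lemma dbal2_S:
  assumes "dbal2 f"
  shows "dbal (\<lambda>y y'. S X (\<lambda>x x'. f x y x' y'))"
  using assms S_takeuchi[OF dbal2_left[OF assms]]
  by (intro balancedI) (simp_all add: dbal2_def cop_sum_distrib)

text \<open>
  Coassociativity is applied to \<open>X\<close> first, since the sum over the components of \<open>X\<close> must stay innermost
  for the summand to be balanced in the components of \<open>Y\<close>.
\<close>

lemma S2_coassoc:
  fixes F :: "'l \<Rightarrow> 'l \<Rightarrow> 'l \<Rightarrow> 'l \<Rightarrow> 'l \<Rightarrow> 'l \<Rightarrow> 'g::ab_group_add"
  assumes 1: "\<And>x3 y3. dbal2 (\<lambda>x1 y1 x2 y2. F x1 y1 x2 y2 x3 y3)"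
    and 2: "\<And>x1 y1. dbal2 (\<lambda>x2 y2 x3 y3. F x1 y1 x2 y2 x3 y3)"
  shows "S2 X Y (\<lambda>x y x3 y3. S2 x y (\<lambda>x1 y1 x2 y2. F x1 y1 x2 y2 x3 y3)) =
    S2 X Y (\<lambda>x1 y1 x y. S2 x y (\<lambda>x2 y2 x3 y3. F x1 y1 x2 y2 x3 y3))"
proof -
  define K where "K y1 y2 y3 = S X (\<lambda>x x3. S x (\<lambda>x1 x2. F x1 y1 x2 y2 x3 y3))" for y1 y2 y3
  have K: "K y1 y2 y3 = S X (\<lambda>x1 x. S x (\<lambda>x2 x3. F x1 y1 x2 y2 x3 y3))" for y1 y2 y3
    unfolding K_def by (rule S_coassoc) (auto intro: dbal2_left[OF 1] dbal2_left[OF 2])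
  have K1: "dbal (\<lambda>y1 y2. K y1 y2 y3)" for y3
    unfolding K_def by (intro balanced_cop_sum dbal2_S[OF 1])
  have K2: "dbal (\<lambda>y2 y3. K y1 y2 y3)" for y1
    unfolding K by (intro balanced_cop_sum dbal2_S[OF 2])
  have "S2 X Y (\<lambda>x y x3 y3. S2 x y (\<lambda>x1 y1 x2 y2. F x1 y1 x2 y2 x3 y3)) =
      S Y (\<lambda>y y3. S y (\<lambda>y1 y2. K y1 y2 y3))"
    unfolding S2_def K_def by (intro cop_sum_cong cop_sum_swap)
  also have "\<dots> = S Y (\<lambda>y1 y. S y (\<lambda>y2 y3. K y1 y2 y3))"
    by (rule S_coassoc[OF K1 K2])
  also have "\<dots> = S2 X Y (\<lambda>x1 y1 x y. S2 x y (\<lambda>x2 y2 x3 y3. F x1 y1 x2 y2 x3 y3))"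
    unfolding S2_def K by (intro cop_sum_cong cop_sum_swap)
  finally show ?thesis .
qed

lemma S2_counit:
  assumes "\<And>x y. h (x + y) = h x + (h y :: 'g::ab_group_add)"
  shows "S2 X Y (\<lambda>x y x' y'. h (s (e (x \<cdot> y)) \<cdot> (x' \<cdot> y'))) = h (X \<cdot> Y)"
proof -
  have "dbal (\<lambda>x y. h (s (e x) \<cdot> y))"
    by (rule balancedI) (simp_all add: assms)
  from S_mult[OF this, of X Y] show ?thesis
    by (simp add: S2_swap S_counit_left assms)
qed

end

section \<open>Sums over \<open>X\<^sub>+ \<otimes> X\<^sub>-\<close>\<close>

locale hopf_algebroid = bialgebroid L
  for L :: "('k::field, 'b::ab_group_add, 'l::ab_group_add) algebroid" (structure) +
  assumes hopf: "left_hopf_algebroid L"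
begin


text \<open>
  The Galois map \<open>X \<otimes> Y \<mapsto> X\<^sub>1 \<diamondop> X\<^sub>2 Y\<close> on formal sums.
\<close>

definition galois_sum :: "('l \<times> 'l) multiset \<Rightarrow> ('l \<times> 'l) multiset" where
  "galois_sum u = (\<Sum>(X, Y)\<in>#u. {#(x1, x2 \<cdot> Y). (x1, x2) \<in># sw L X#})"

lemma sum_galois_sum: "(\<Sum>(x, y)\<in>#galois_sum u. f x y) = (\<Sum>(x, y)\<in>#u. S x (\<lambda>p q. f p (q \<cdot> y)))"
  by (simp add: galois_sum_def cop_sum_def case_prod_unfold image_mset.compositionality comp_def sum_mset_sum_mset)

lemma dbal_mult_right: "dbal f \<Longrightarrow> dbal (\<lambda>x y. f x (y \<cdot> z))"
  by (simp add: balanced_def)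

lemma obal_mult_right: "obal f \<Longrightarrow> obal (\<lambda>x y. f x (y \<cdot> z))"
  by (simp add: balanced_def)

lemma obal_galois: "dbal f \<Longrightarrow> obal (\<lambda>x y. S x (\<lambda>p q. f p (q \<cdot> y)))"
  using dbal_mult_right[of f]
  by (simp add: balanced_def[of _ _ "\<lambda>x y. S x (\<lambda>p q. f p (q \<cdot> y))"] S_add S_tgt_right)
    (simp add: balanced_def cop_sum_distrib)

lemma galois_sum_cong: "(u, v) \<in> otb L \<Longrightarrow> (galois_sum u, galois_sum v) \<in> dia L"
  unfolding tcong_iff[of "galois_sum u"] sum_galois_sum by (rule balanced_sum_cong[OF _ obal_galois[OF balanced_tensor_class]])

lemma equiv_dia: "equiv UNIV (dia L)" and equiv_otb: "equiv UNIV (otb L)"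
  using group_cong_tcong by (auto simp: group_cong_def)

lemma galois_class: "galois L (otb L `` {u}) = dia L `` {galois_sum u}"
  unfolding galois_def induced_def galois_sum_def[symmetric]
  using galois_sum_cong formal_cong.refl formal_cong.trans formal_cong.sym by blast

lemma galois_sum_inj: "(galois_sum u, galois_sum v) \<in> dia L \<Longrightarrow> (u, v) \<in> otb L"
proof -
  assume "(galois_sum u, galois_sum v) \<in> dia L"
  then have "galois L (otb L `` {u}) = galois L (otb L `` {v})"
    unfolding galois_class by (rule equiv_class_eq[OF equiv_dia])
  moreover have "inj_on (galois L) (UNIV // otb L)"
    using hopf by (simp add: left_hopf_algebroid_def bij_betw_def)
  ultimately have "otb L `` {u} = otb L `` {v}"
    by (auto dest: inj_onD intro: quotientI simp del: Image_singleton_iff)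
  then show ?thesis by (simp add: eq_equiv_class[OF _ equiv_otb])
qed

lemma galois_sum_pm: "(galois_sum (pm L X), {#(X, \<^bold>1)#}) \<in> dia L"
proof -
  let ?c = "the_inv_into (UNIV // otb L) (galois L) (dia L `` {{#(X, \<^bold>1)#}})"
  have bij: "bij_betw (galois L) (UNIV // otb L) (UNIV // dia L)"
    using hopf by (simp add: left_hopf_algebroid_def)
  have im: "dia L `` {{#(X, \<^bold>1)#}} \<in> UNIV // dia L" by (auto intro: quotientI)
  have c: "?c \<in> UNIV // otb L" and g: "galois L ?c = dia L `` {{#(X, \<^bold>1)#}}"
    using im the_inv_into_into[of "galois L" "UNIV // otb L", OF _ _ subset_refl]
      f_the_inv_into_f_bij_betw[OF bij] bij
    unfolding bij_betw_def by simp_all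
  obtain u where u: "?c = otb L `` {u}" using c by (auto simp: quotient_def)
  then have "\<exists>v. v \<in> ?c" by (auto intro: formal_cong.refl)
  then have "pm L X \<in> ?c" unfolding pm_def rep_def by (rule someI_ex)
  then have "?c = otb L `` {pm L X}"
    using equiv_class_eq[OF equiv_otb] u by auto
  then show ?thesis using g galois_class eq_equiv_class[OF _ equiv_dia] by auto
qed

text \<open>
  Injectivity of the Galois map, in terms of test functions.  As the Galois map has values in
  \<open>L \<diamondop> L\<close>, the test functions of the premise have values in \<open>quot_group\<close>.
\<close>

lemma otb_sum_eqI:
  assumes "\<And>f :: 'l \<Rightarrow> 'l \<Rightarrow> ('l \<times> 'l) quot_group. dbal f \<Longrightarrow>
      (\<Sum>(x, y)\<in>#u. S x (\<lambda>p q. f p (q \<cdot> y))) = (\<Sum>(x, y)\<in>#v. S x (\<lambda>p q. f p (q \<cdot> y)))"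
    and "obal g"
  shows "(\<Sum>(x, y)\<in>#u. g x y) = (\<Sum>(x, y)\<in>#v. g x y)"
proof -
  have "(galois_sum u, galois_sum v) \<in> dia L"
    unfolding tcong_iff sum_galois_sum using assms(1) balanced_tensor_class by blast
  then show ?thesis using galois_sum_inj balanced_sum_cong assms(2) by blast
qed

text \<open>
  \<open>X\<^sub>+\<^sub>1 \<diamondop> X\<^sub>+\<^sub>2 X\<^sub>- = X \<diamondop> 1\<close>, the defining property of \<open>X\<^sub>+ \<otimes> X\<^sub>-\<close>.
\<close>

lemma P_galois: "dbal f \<Longrightarrow> P X (\<lambda>x y. S x (\<lambda>p q. f p (q \<cdot> y))) = f X \<^bold>1"
  using balanced_sum_cong[OF galois_sum_pm, of f X] by (simp add: sum_galois_sum pm_sum_def)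

lemma P_galois_right: "dbal f \<Longrightarrow> P X (\<lambda>x y. S x (\<lambda>p q. f p (q \<cdot> (y \<cdot> z)))) = f X z"
  using P_galois[of "\<lambda>x y. f x (y \<cdot> z)" X] dbal_mult_right[of f z] by simp

text \<open>
  Any formal sum with Galois image \<open>X \<diamondop> 1\<close> computes the sums over \<open>X\<^sub>+ \<otimes> X\<^sub>-\<close>.  The behaviour of
  \<open>X\<^sub>+ \<otimes> X\<^sub>-\<close> under addition, multiplication and the four actions of the base is obtained from this.
\<close>

lemma P_eqI:
  assumes "\<And>f :: 'l \<Rightarrow> 'l \<Rightarrow> ('l \<times> 'l) quot_group. dbal f \<Longrightarrow>
      (\<Sum>(x, y)\<in>#u. S x (\<lambda>p q. f p (q \<cdot> y))) = f X \<^bold>1"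
    and "obal g"
  shows "P X g = (\<Sum>(x, y)\<in>#u. g x y)"
  unfolding pm_sum_def
  by (rule otb_sum_eqI[OF _ assms(2)]) (simp add: assms(1) P_galois[unfolded pm_sum_def])

lemma P_add:
  assumes "obal g"
  shows "P (X + Y) g = P X g + P Y g"
proof -
  have "P (X + Y) g = (\<Sum>(x, y)\<in>#pm L X + pm L Y. g x y)"
    by (rule P_eqI[OF _ assms]) (simp add: P_galois[unfolded pm_sum_def], simp add: balanced_def)
  then show ?thesis by (simp add: pm_sum_def)
qed

lemma P_image:
  "(\<Sum>(x, y)\<in>#{#(h x y, k x y). (x, y) \<in># pm L X#}. f x y) = P X (\<lambda>x y. f (h x y) (k x y))"
  by (simp add: pm_sum_def case_prod_unfold image_mset.compositionality comp_def)

lemma P_one: assumes "obal g" shows "P \<^bold>1 g = g \<^bold>1 \<^bold>1"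
  using P_eqI[of "{#(\<^bold>1, \<^bold>1)#}" "\<^bold>1", OF _ assms] by (simp add: S_one)

lemma P_src_left:
  assumes "obal g" shows "P (s a \<cdot> X) g = P X (\<lambda>x y. g (s a \<cdot> x) y)"
proof (subst P_image[symmetric], rule P_eqI[OF _ assms], subst P_image)
  fix f :: "'l \<Rightarrow> 'l \<Rightarrow> ('l \<times> 'l) quot_group" assume f: "dbal f"
  then have "dbal (\<lambda>x y. f (s a \<cdot> x) y)" by (simp add: balanced_def flip: tgt_src_left)
  from P_galois[OF this] f show "P X (\<lambda>x y. S (s a \<cdot> x) (\<lambda>p q. f p (q \<cdot> y))) = f (s a \<cdot> X) \<^bold>1"
    by (simp add: S_src_left dbal_mult_right)
qed

lemma P_tgt_left:
  assumes "obal g" shows "P (t a \<cdot> X) g = P X (\<lambda>x y. g x (y \<cdot> s a))"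
proof (subst P_image[symmetric], rule P_eqI[OF _ assms], subst P_image)
  fix f :: "'l \<Rightarrow> 'l \<Rightarrow> ('l \<times> 'l) quot_group" assume f: "dbal f"
  then have "f X (s a) = f (t a \<cdot> X) \<^bold>1" by (simp add: balanced_def)
  then show "P X (\<lambda>x y. S x (\<lambda>p q. f p (q \<cdot> (y \<cdot> s a)))) = f (t a \<cdot> X) \<^bold>1"
    by (simp add: P_galois_right f)
qed

lemma P_tgt_right:
  assumes "obal g" shows "P (X \<cdot> t a) g = P X (\<lambda>x y. g x (s a \<cdot> y))"
proof (subst P_image[symmetric], rule P_eqI[OF _ assms], subst P_image)
  fix f :: "'l \<Rightarrow> 'l \<Rightarrow> ('l \<times> 'l) quot_group" assume f: "dbal f"
  then have 1: "dbal (\<lambda>x y. f (x \<cdot> t a) y)" by (simp add: balanced_def)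
  have "S x (\<lambda>p q. f p (q \<cdot> (s a \<cdot> y))) = S x (\<lambda>p q. f (p \<cdot> t a) (q \<cdot> y))" for x y
    using S_takeuchi[OF dbal_mult_right[OF f, of y]] by simp
  then show "P X (\<lambda>x y. S x (\<lambda>p q. f p (q \<cdot> (s a \<cdot> y)))) = f (X \<cdot> t a) \<^bold>1"
    using P_galois[OF 1] by simp
qed

text \<open>
  \<open>t(b) X\<^sub>+ \<otimes> X\<^sub>- = X\<^sub>+ \<otimes> X\<^sub>- t(b)\<close>, since both sides have the Galois image \<open>X \<diamondop> t(b)\<close>.
\<close>

lemma P_takeuchi:
  assumes "obal g" shows "P X (\<lambda>x y. g (t b \<cdot> x) y) = P X (\<lambda>x y. g x (y \<cdot> t b))"
proof -
  have eq: "P X (\<lambda>x y. S (t b \<cdot> x) (\<lambda>p q. f p (q \<cdot> y))) = P X (\<lambda>x y. S x (\<lambda>p q. f p (q \<cdot> (y \<cdot> t b))))"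
    if f: "dbal f" for f :: "'l \<Rightarrow> 'l \<Rightarrow> ('l \<times> 'l) quot_group"
  proof -
    have "dbal (\<lambda>x y. f x (t b \<cdot> y))" using f by (simp add: balanced_def tgt_src_left)
    from P_galois[OF this] show ?thesis using f
      by (simp add: S_tgt_left dbal_mult_right P_galois_right)
  qed
  from otb_sum_eqI[of "{#(t b \<cdot> x, y). (x, y) \<in># pm L X#}" "{#(x, y \<cdot> t b). (x, y) \<in># pm L X#}", OF _ assms]
  show ?thesis unfolding P_image using eq by blast
qed

text \<open>
  \<open>X\<^sub>1\<^sub>+ \<otimes> X\<^sub>1\<^sub>- X\<^sub>2 = X \<otimes> 1\<close>, since both sides have the Galois image \<open>X\<^sub>1 \<diamondop> X\<^sub>2\<close>.
\<close>

lemma S_P_cancel: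
  assumes "obal g"
  shows "S X (\<lambda>x y. P x (\<lambda>p q. g p (q \<cdot> y))) = g X \<^bold>1"
proof -
  let ?u = "\<Sum>(x, y)\<in>#sw L X. {#(p, q \<cdot> y). (p, q) \<in># pm L x#}"
  have sum_u: "(\<Sum>(x, y)\<in>#?u. h x y) = S X (\<lambda>x y. P x (\<lambda>p q. h p (q \<cdot> y)))"
    for h :: "'l \<Rightarrow> 'l \<Rightarrow> 'h::ab_group_add"
    by (simp add: cop_sum_def pm_sum_def case_prod_unfold image_mset.compositionality comp_def sum_mset_sum_mset)
  have "(\<Sum>(x, y)\<in>#?u. g x y) = (\<Sum>(x, y)\<in>#{#(X, \<^bold>1)#}. g x y)"
    by (rule otb_sum_eqI[OF _ assms], subst sum_u) (simp add: P_galois_right)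
  then show ?thesis by (simp add: sum_u)
qed

lemma S_P_cancel_right: "obal g \<Longrightarrow> S X (\<lambda>x y. P x (\<lambda>p q. g p (q \<cdot> (y \<cdot> z)))) = g X z"
  using S_P_cancel[of "\<lambda>x y. g x (y \<cdot> z)" X] obal_mult_right[of g z] by simp

lemma dbal_P:
  assumes "obal g"
  shows "dbal (\<lambda>x y. P x (\<lambda>p q. g p (q \<cdot> y)))"
  using assms obal_mult_right[OF assms]
  by (simp add: balanced_def[of _ _ "\<lambda>x y. P x (\<lambda>p q. g p (q \<cdot> y))"] P_add P_tgt_left)
    (simp add: balanced_def pm_sum_distrib)

text \<open>
  \<open>X\<^sub>+\<^sub>1 \<otimes> X\<^sub>+\<^sub>2 \<otimes> X\<^sub>- = X\<^sub>1 \<otimes> X\<^sub>2\<^sub>+ \<otimes> X\<^sub>2\<^sub>-\<close>.  By \<open>S_P_cancel\<close>, \<open>F\<close> can be written as a sum over \<open>\<Delta>\<close> of its second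
  argument; coassociativity then collects both coproducts in front of \<open>X\<^sub>-\<close>, where \<open>P_galois\<close> applies.
\<close>

lemma P_cop_plus:
  assumes F1: "\<And>z. dbal (\<lambda>x y. F x y z)" and F2: "\<And>x. obal (F x)"
  shows "P X (\<lambda>w z. S w (\<lambda>x y. F x y z)) = S X (\<lambda>x w. P w (F x))"
proof -
  \<comment> \<open>The map \<open>h\<close> is chosen so that \<open>F x y z\<close> is \<open>h x y\<^sub>1 (y\<^sub>2 z)\<close>.\<close>
  define h where "h x y z = P y (\<lambda>p q. F x p (q \<cdot> z))" for x y z
  have h_cancel: "S y (\<lambda>p q. h x p (q \<cdot> z)) = F x y z" for x y z
    unfolding h_def by (rule S_P_cancel_right[OF F2])
  have h2: "dbal (h x)" for x
    unfolding h_def by (rule dbal_P[OF F2])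
  have h1: "dbal (\<lambda>x y. h x y z)" for z
  proof -
    have "obal (\<lambda>p q. F x p (q \<cdot> z))" for x by (rule obal_mult_right[OF F2])
    then show ?thesis
      using F1 unfolding h_def
      by (simp add: balanced_def[of _ _ "\<lambda>x y. P y (\<lambda>p q. F x p (q \<cdot> z))"] P_add P_src_left)
        (simp add: balanced_def pm_sum_distrib)
  qed
  define f where "f w z = S w (\<lambda>x y. h x y z)" for w z
  have f: "dbal f"
    using h1 h2 unfolding f_def
    by (simp add: balanced_def[of _ _ "\<lambda>w z. S w (\<lambda>x y. h x y z)"] S_add S_tgt_left)
      (simp add: balanced_def cop_sum_distrib)
  have "P X (\<lambda>w z. S w (\<lambda>x y. F x y z)) = P X (\<lambda>w z. S w (\<lambda>x y. S y (\<lambda>p q. h x p (q \<cdot> z))))"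
    by (simp add: h_cancel)
  also have "\<dots> = P X (\<lambda>w z. S w (\<lambda>v y. S v (\<lambda>x p. h x p (y \<cdot> z))))"
    by (subst S_coassoc) (auto intro: h1 dbal_mult_right[OF h2])
  also have "\<dots> = P X (\<lambda>w z. S w (\<lambda>v y. f v (y \<cdot> z)))"
    by (simp add: f_def)
  also have "\<dots> = f X \<^bold>1" by (rule P_galois[OF f])
  also have "\<dots> = S X (\<lambda>x w. P w (F x))" by (simp add: f_def h_def)
  finally show ?thesis .
qed

text \<open>
  \<open>X\<^sub>+ \<otimes> X\<^sub>-\<^sub>1 \<otimes> X\<^sub>-\<^sub>2 = X\<^sub>+\<^sub>+ \<otimes> X\<^sub>- \<otimes> X\<^sub>+\<^sub>-\<close>.  With a further factor \<open>Y\<close>, the sum \<open>B(X, Y)\<close> of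
  \<open>H(X\<^sub>+\<^sub>+, X\<^sub>- Y\<^sub>1, X\<^sub>+\<^sub>- Y\<^sub>2)\<close> is balanced, and cancelling twice gives \<open>B(X\<^sub>1, X\<^sub>2 Y) = H(X, Y\<^sub>1, Y\<^sub>2)\<close>.
  Since \<open>X \<diamondop> 1 = X\<^sub>+\<^sub>1 \<diamondop> X\<^sub>+\<^sub>2 X\<^sub>-\<close>, the value \<open>B(X, 1)\<close> is both sides of the equation.
\<close>

lemma P_cop_minus:
  assumes H1: "\<And>x. dbal (H x)" and H2: "\<And>y. obal (\<lambda>x z. H x y z)"
  shows "P X (\<lambda>x y. S y (H x)) = P X (\<lambda>x y. P x (\<lambda>p q. H p y q))"
proof -
  define f where "f X Y1 Y2 = P X (\<lambda>x y. P x (\<lambda>p q. H p (y \<cdot> Y1) (q \<cdot> Y2)))" for X Y1 Y2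
  have H2': "obal (\<lambda>x z. H x y (z \<cdot> w))" for y w by (rule obal_mult_right[OF H2])
  have o: "obal (\<lambda>x y. P x (\<lambda>p q. H p (y \<cdot> u) (q \<cdot> v)))" for u v
    using H1 H2'
    by (simp add: balanced_def[of _ _ "\<lambda>x y. P x (\<lambda>p q. H p (y \<cdot> u) (q \<cdot> v))"] P_add P_tgt_right)
      (simp add: balanced_def pm_sum_distrib)
  have f_d: "dbal (f X)" for X
  proof -
    have "f X (t b \<cdot> Y1) Y2 = f X Y1 (s b \<cdot> Y2)" for b Y1 Y2
      using P_takeuchi[OF o[of Y1 Y2]] by (simp add: f_def P_tgt_left[OF H2'])
    then show ?thesis
      using H1 H2 by (simp add: balanced_def f_def pm_sum_distrib)
  qed
  have f_add: "f (X + X') Y1 Y2 = f X Y1 Y2 + f X' Y1 Y2" for X X' Y1 Y2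
    unfolding f_def by (rule P_add[OF o])
  define B where "B X Y = S Y (f X)" for X Y
  have f_tgt: "f (t b \<cdot> X) Y1 Y2 = f X (s b \<cdot> Y1) Y2" for b X Y1 Y2
    unfolding f_def using P_tgt_left[OF o[of Y1 Y2]] by simp
  have "f (X + X') = (\<lambda>u v. f X u v + f X' u v)" "f (t b \<cdot> X) = (\<lambda>u v. f X (s b \<cdot> u) v)" for b X X'
    by (intro ext; simp add: f_add f_tgt)+
  then have B: "dbal B"
    unfolding balanced_def B_def
    by (auto simp: S_add[OF f_d] S_src_left[OF f_d] cop_sum_distrib)
  have f_cancel: "S X (\<lambda>x y. S y (\<lambda>p q. f x (p \<cdot> u) (q \<cdot> v))) = H X u v" for X u v
  proof -
    have "S X (\<lambda>x y. S y (\<lambda>p q. f x (p \<cdot> u) (q \<cdot> v))) = S X (\<lambda>w q. S w (\<lambda>x p. f x (p \<cdot> u) (q \<cdot> v)))"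
      by (subst S_coassoc) (use f_d f_add f_tgt in \<open>auto simp: balanced_def\<close>)
    also have "\<dots> = S X (\<lambda>w q. P w (\<lambda>p r. H p u (r \<cdot> (q \<cdot> v))))"
    proof -
      have "obal (\<lambda>a z. P a (\<lambda>p r. H p z (r \<cdot> (q \<cdot> v))))" for q
        using o[of "\<^bold>1" "q \<cdot> v"] by simp
      from S_P_cancel_right[OF this] show ?thesis by (simp add: f_def)
    qed
    also have "\<dots> = H X u v" by (rule S_P_cancel_right[OF H2])
    finally show ?thesis .
  qed
  have "P X (\<lambda>x y. P x (\<lambda>p q. H p y q)) = B X \<^bold>1"
    by (simp add: B_def S_one[OF f_d] f_def)
  also have "\<dots> = P X (\<lambda>x y. S x (\<lambda>p q. B p (q \<cdot> y)))" by (rule P_galois[OF B, symmetric])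
  also have "\<dots> = P X (\<lambda>x y. S x (\<lambda>p q. S q (\<lambda>q1 q2. S y (\<lambda>y1 y2. f p (q1 \<cdot> y1) (q2 \<cdot> y2)))))"
    by (simp add: B_def S_mult[OF f_d])
  also have "\<dots> = P X (\<lambda>x y. S y (\<lambda>y1 y2. S x (\<lambda>p q. S q (\<lambda>q1 q2. f p (q1 \<cdot> y1) (q2 \<cdot> y2)))))"
  proof -
    have "S x (\<lambda>p q. S q (\<lambda>q1 q2. S y (\<lambda>y1 y2. f p (q1 \<cdot> y1) (q2 \<cdot> y2)))) =
        S x (\<lambda>p q. S y (\<lambda>y1 y2. S q (\<lambda>q1 q2. f p (q1 \<cdot> y1) (q2 \<cdot> y2))))" for x y
      by (rule arg_cong[of _ _ "S x"], intro ext, rule cop_sum_swap)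
    then have "S x (\<lambda>p q. S q (\<lambda>q1 q2. S y (\<lambda>y1 y2. f p (q1 \<cdot> y1) (q2 \<cdot> y2)))) =
        S y (\<lambda>y1 y2. S x (\<lambda>p q. S q (\<lambda>q1 q2. f p (q1 \<cdot> y1) (q2 \<cdot> y2))))" for x y
      by (rule HOL.trans[OF _ cop_sum_swap])
    then show ?thesis by simp
  qed
  also have "\<dots> = P X (\<lambda>x y. S y (H x))" by (simp add: f_cancel)
  finally show ?thesis by simp
qed

text \<open>
  The Galois image of \<open>X\<^sub>+ Y\<^sub>+ \<otimes> Y\<^sub>- X\<^sub>-\<close> is \<open>X\<^sub>+\<^sub>1 Y\<^sub>+\<^sub>1 \<diamondop> X\<^sub>+\<^sub>2 Y\<^sub>+\<^sub>2 Y\<^sub>- X\<^sub>-\<close>, which collapses to \<open>X Y \<diamondop> 1\<close>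
  from the inside: \<open>P_galois\<close> removes first \<open>Y\<^sub>-\<close>, then \<open>X\<^sub>-\<close>.
\<close>

lemma P_mult:
  assumes g: "obal g"
  shows "P (X \<cdot> Y) g = P X (\<lambda>x x'. P Y (\<lambda>y y'. g (x \<cdot> y) (y' \<cdot> x')))"
proof -
  let ?u = "\<Sum>(x, x')\<in>#pm L X. {#(x \<cdot> y, y' \<cdot> x'). (y, y') \<in># pm L Y#}"
  have sum_u: "(\<Sum>(x, y)\<in>#?u. h x y) = P X (\<lambda>x x'. P Y (\<lambda>y y'. h (x \<cdot> y) (y' \<cdot> x')))"
    for h :: "'l \<Rightarrow> 'l \<Rightarrow> 'h::ab_group_add"
    by (simp add: pm_sum_def case_prod_unfold image_mset.compositionality comp_def sum_mset_sum_mset)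
  have "P (X \<cdot> Y) g = (\<Sum>(x, y)\<in>#?u. g x y)"
  proof (rule P_eqI[OF _ g], subst sum_u)
    fix f :: "'l \<Rightarrow> 'l \<Rightarrow> ('l \<times> 'l) quot_group" assume f: "dbal f"
    have "dbal (\<lambda>z w. S x (\<lambda>p q. f (p \<cdot> z) (q \<cdot> (w \<cdot> x'))))" for x x'
    proof (rule balancedI)
      fix b z w
      have "dbal (\<lambda>p q. f (p \<cdot> z) (q \<cdot> (w \<cdot> x')))" using f by (simp add: balanced_def)
      from S_takeuchi[OF this, of x b]
      show "S x (\<lambda>p q. f (p \<cdot> (t b \<cdot> z)) (q \<cdot> (w \<cdot> x'))) =
          S x (\<lambda>p q. f (p \<cdot> z) (q \<cdot> ((s b \<cdot> w) \<cdot> x')))" by simp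
    qed (use f in \<open>simp_all add: balanced_def cop_sum_distrib\<close>)
    from P_galois[OF this, of Y]
    have "P Y (\<lambda>y y'. S (x \<cdot> y) (\<lambda>p q. f p (q \<cdot> (y' \<cdot> x')))) = S x (\<lambda>p q. f (p \<cdot> Y) (q \<cdot> x'))" for x x'
      by (simp add: S_mult dbal_mult_right f cop_sum_swap[of L x])
    moreover have "dbal (\<lambda>p q. f (p \<cdot> Y) q)" using f by (simp add: balanced_def)
    ultimately show "P X (\<lambda>x x'. P Y (\<lambda>y y'. S (x \<cdot> y) (\<lambda>p q. f p (q \<cdot> (y' \<cdot> x'))))) = f (X \<cdot> Y) \<^bold>1"
      using P_galois by simp
  qed
  then show ?thesis by (simp add: sum_u)
qed

text \<open>
  \<open>X = X\<^sub>+ t(\<epsilon>(X\<^sub>-))\<close>, by applying \<open>x \<diamondop> y \<mapsto> t(\<epsilon>(y)) x\<close> to \<open>X\<^sub>+\<^sub>1 \<diamondop> X\<^sub>+\<^sub>2 X\<^sub>- = X \<diamondop> 1\<close>.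
\<close>

lemma P_counit:
  assumes "\<And>x y. h (x + y) = h x + (h y :: 'g::ab_group_add)"
  shows "P X (\<lambda>x y. h (x \<cdot> t (e y))) = h X"
proof -
  have d: "dbal (\<lambda>x y. h (t (e y) \<cdot> x))" by (rule balancedI) (simp_all add: assms)
  have "S x (\<lambda>p q. h (t (e (q \<cdot> y)) \<cdot> p)) = h (x \<cdot> t (e y))" for x y
    using S_counit_right[of h "x \<cdot> t (e y)"] S_tgt_right[OF d] by (simp add: assms cou_mult)
  then show ?thesis using P_galois[OF d] by simp
qed

text \<open>
  \<open>X\<^sub>+\<^sub>1 \<otimes> X\<^sub>-\<^sub>1 \<otimes> X\<^sub>+\<^sub>2 X\<^sub>-\<^sub>2 = X\<^sub>+ \<otimes> X\<^sub>- \<otimes> 1\<close>: \<open>P_cop_minus\<close> turns the left-hand side into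
  \<open>X\<^sub>+\<^sub>+\<^sub>1 \<otimes> X\<^sub>- \<otimes> X\<^sub>+\<^sub>+\<^sub>2 X\<^sub>+\<^sub>-\<close>, where \<open>P_galois\<close> applies to \<open>X\<^sub>+\<close>.  It replaces the cancellation of an
  element against its antipode.
\<close>

lemma P_cop_both:
  assumes F1: "\<And>y. dbal (\<lambda>x z. F x y z)" and F2: "\<And>z. obal (\<lambda>x y. F x y z)"
  shows "P X (\<lambda>x y. S x (\<lambda>p q. S y (\<lambda>p' q'. F p p' (q \<cdot> q')))) = P X (\<lambda>x y. F x y \<^bold>1)"
proof -
  define H where "H x y z = S x (\<lambda>p q. F p y (q \<cdot> z))" for x y z
  have H1: "dbal (H x)" for x
    using F1 F2 S_takeuchi[OF dbal_mult_right[OF F1]] unfolding H_def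
    by (intro balancedI) (simp_all add: balanced_def cop_sum_distrib)
  have H2: "obal (\<lambda>x z. H x y z)" for y
    unfolding H_def by (rule obal_galois[OF F1])
  have "P X (\<lambda>x y. S x (\<lambda>p q. S y (\<lambda>p' q'. F p p' (q \<cdot> q')))) = P X (\<lambda>x y. S y (H x))"
    unfolding H_def by (intro pm_sum_cong cop_sum_swap)
  also have "\<dots> = P X (\<lambda>x y. P x (\<lambda>p q. H p y q))"
    by (rule P_cop_minus[OF H1 H2])
  also have "\<dots> = P X (\<lambda>x y. F x y \<^bold>1)"
    unfolding H_def by (intro pm_sum_cong P_galois[OF F1])
  finally show ?thesis .
qed

end

section \<open>Consequences of the cocycle identity\<close>

locale bilinear_cocycle = hopf_algebroid L
  for L :: "('k::field, 'b::ab_group_add, 'l::ab_group_add) algebroid" (structure) +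
  fixes G G' :: "'l \<Rightarrow> 'l \<Rightarrow> 'b"
  assumes cocycle: "bilinear_left_2_cocycle L G"
    and inverse: "convolution_inverse L G G'"
begin

lemma G_Be: "Be_linear L G" and G'_Be: "Be_linear L G'"
  using cocycle inverse by (auto simp: bilinear_left_2_cocycle_def convolution_inverse_def)

lemmas G = Be_linear_simps[OF G_Be] Be_linear_simps[OF G'_Be]
lemmas G_sums = Be_linear_sums[OF G_Be] Be_linear_sums[OF G'_Be]

abbreviation m where "m \<equiv> left_twisted_mult L G"

lemma m_S2: "m X Y = S2 X Y (\<lambda>x y x' y'. s (G x y) \<cdot> (x' \<cdot> y'))"
  unfolding S2_swap left_twisted_mult_def cop_sum_def ..

lemma G_m: "G X (m Y Z) = G (m X Y) Z"
  using cocycle by (simp add: bilinear_left_2_cocycle_def)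

lemma G_one [simp]: "G \<^bold>1 X = e X" "G X \<^bold>1 = e X"
  using cocycle by (simp_all add: bilinear_left_2_cocycle_def)

lemma G_src_tgt: "G X (Y \<cdot> t b) = G X (Y \<cdot> s b)"
  using cocycle by (simp add: bilinear_left_2_cocycle_def)

lemma G_src: "G X (s b) = e (X \<cdot> s b)"
  using G(7)[of X b "\<^bold>1"] by simp

lemma convolution_S2: "convolution L f g X Y = S2 X Y (\<lambda>x y x' y'. f x y \<star> g x' y')"
  unfolding S2_swap convolution_def cop_sum_def ..

lemma conv: "S2 X Y (\<lambda>x y x' y'. G x y \<star> G' x' y') = e (X \<cdot> Y)"
    "S2 X Y (\<lambda>x y x' y'. G' x y \<star> G x' y') = e (X \<cdot> Y)"
  using inverse by (simp_all add: convolution_inverse_def flip: convolution_S2)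

lemma dbal2_conv:
  assumes f: "Be_linear L f" and g: "Be_linear L g"
  shows "dbal2 (\<lambda>x y x' y'. f x y \<star> g x' y')"
  by (simp add: dbal2_def balanced_def Be_linear_simps[OF f] Be_linear_simps[OF g])

lemma dbal2_m: "dbal2 (\<lambda>x y x' y'. s (G x y) \<cdot> (x' \<cdot> y'))"
  by (simp add: dbal2_def balanced_def G)

text \<open>
  By \<open>\<Gamma> * \<Gamma>\<^sup>-\<^sup>1 = \<epsilon>\<close> at \<open>(1, X)\<close>, where \<open>\<Gamma>\<close> drops out by its own normalisation.
\<close>

lemma G'_one [simp]: "G' \<^bold>1 X = e X"
proof -
  have "e X = S X (\<lambda>y y'. e y \<star> G' \<^bold>1 y')"
    using conv(1)[of "\<^bold>1" X]
    by (simp add: S2_def S_one[OF dbal2_left[OF dbal2_conv[OF G_Be G'_Be]]])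
  also have "\<dots> = S X (\<lambda>y y'. G' \<^bold>1 (s (e y) \<cdot> y'))"
    using G(17)[of "\<^bold>1"] by (simp add: G)
  also have "\<dots> = G' \<^bold>1 X" by (rule S_counit_left) (simp add: G)
  finally show ?thesis by simp
qed

lemma m_linear:
  "m (X + X') Y = m X Y + m X' Y" "m X (Y + Y') = m X Y + m X Y'"
  "m (s a \<cdot> X) Y = s a \<cdot> m X Y" "m (X \<cdot> s a) Y = m X (s a \<cdot> Y)" "m (X \<cdot> t a) Y = m X (t a \<cdot> Y)"
proof -
  note d = dbal2_m[THEN dbal2_left]
  show "m (X + X') Y = m X Y + m X' Y"
    by (simp add: m_S2 S2_def S_add[OF d] cop_sum_distrib)
  show "m X (Y + Y') = m X Y + m X Y'"
    by (simp add: m_S2 S2_def S_add[OF dbal2_S[OF dbal2_m]] cop_sum_distrib)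
  show "m (s a \<cdot> X) Y = s a \<cdot> m X Y"
    by (simp add: m_S2 S2_def S_src_left[OF d] mult_additive_sums G)
  show "m (X \<cdot> s a) Y = m X (s a \<cdot> Y)"
    by (simp add: m_S2 S2_def S_src_right[OF d] S_src_left[OF dbal2_S[OF dbal2_m]] G)
  show "m (X \<cdot> t a) Y = m X (t a \<cdot> Y)"
    by (simp add: m_S2 S2_def S_tgt_right[OF d] S_tgt_left[OF dbal2_S[OF dbal2_m]] G)
qed

text \<open>
  The product of \<open>L\<close> recovered from the product \<open>m\<close> twisted on the left.  Inserting this in an argument
  of \<open>\<Gamma>\<close> is how the cocycle identity is used: it expands \<open>\<Gamma>(X Y, Z)\<close> and \<open>\<Gamma>(X, Y Z)\<close>.
\<close>

lemma mult_eq_m: "S2 X Y (\<lambda>x y x' y'. s (G' x y) \<cdot> m x' y') = X \<cdot> Y"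
proof -
  have "S2 X Y (\<lambda>x y x' y'. s (G' x y) \<cdot> m x' y') =
      S2 X Y (\<lambda>x1 y1 x y. S2 x y (\<lambda>x2 y2 x3 y3. s (G' x1 y1 \<star> G x2 y2) \<cdot> (x3 \<cdot> y3)))"
    by (simp add: m_S2 S2_def mult_additive_sums)
  also have "\<dots> = S2 X Y (\<lambda>x y x3 y3. S2 x y (\<lambda>x1 y1 x2 y2. s (G' x1 y1 \<star> G x2 y2) \<cdot> (x3 \<cdot> y3)))"
    by (rule S2_coassoc[symmetric]) (simp_all add: dbal2_def balanced_def G)
  also have "\<dots> = S2 X Y (\<lambda>x y x3 y3. s (S2 x y (\<lambda>x1 y1 x2 y2. G' x1 y1 \<star> G x2 y2)) \<cdot> (x3 \<cdot> y3))"
    by (simp add: S2_def mult_additive_sums)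
  also have "\<dots> = X \<cdot> Y" by (simp only: conv S2_counit[of "\<lambda>x. x"])
  finally show ?thesis .
qed

lemma G_mult_left: "G (X \<cdot> Y) Z = S2 X Y (\<lambda>x y x' y'. G' x y \<star> G x' (m y' Z))"
  by (subst mult_eq_m[symmetric]) (simp add: S2_def G_sums G G_m)

lemma G_mult_right: "G X (Y \<cdot> Z) =
    S2 Y Z (\<lambda>y z y' z'. S2 X y' (\<lambda>x y1 x' y2. G x (s (G' y z) \<cdot> y1) \<star> G (x' \<cdot> y2) z'))"
proof -
  have "G X (s c \<cdot> m y z) = S2 X y (\<lambda>x y1 x' y2. G x (s c \<cdot> y1) \<star> G (x' \<cdot> y2) z)" for c y z
  proof -
    have "G X (s c \<cdot> m y z) = G (m (X \<cdot> s c) y) z"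
      by (subst G_m[symmetric]) (simp add: G)
    then show ?thesis
      by (simp only: m_S2) (simp add: S2_def G_sums G S_src_right[OF dbal2_m[THEN dbal2_left]])
  qed
  then show ?thesis
    by (subst mult_eq_m[symmetric]) (simp add: S2_def G_sums)
qed

section \<open>The counit of the cotwist\<close>

definition \<phi> :: "'l \<Rightarrow> 'b" where "\<phi> X = P X G"

lemma obal_G: "obal G"
  by (simp add: balanced_def G)

text \<open>
  \<open>\<phi>\<close> is a bimodule map.  For the right action, \<open>(t(a) X)\<^sub>+ \<otimes> (t(a) X)\<^sub>- = X\<^sub>+ \<otimes> X\<^sub>- s(a)\<close>; this is where
  \<open>\<Gamma>(X, Y s(a)) = \<Gamma>(X, Y t(a))\<close> enters, because \<open>X\<^sub>+ \<otimes> X\<^sub>- t(a)\<close> is \<open>t(a) X\<^sub>+ \<otimes> X\<^sub>-\<close>.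
\<close>

lemma \<phi> [simp]:
  "\<phi> (X + Y) = \<phi> X + \<phi> Y" "\<phi> (s a \<cdot> X) = a \<star> \<phi> X" "\<phi> (t a \<cdot> X) = \<phi> X \<star> a" "\<phi> \<^bold>1 = \<^bold>1\<^bsub>base L\<^esub>"
proof -
  show "\<phi> (t a \<cdot> X) = \<phi> X \<star> a"
    using P_takeuchi[OF obal_G, of X a]
    by (simp add: \<phi>_def P_tgt_left[OF obal_G] G G_src_tgt mult_additive_sums)
qed (simp_all add: \<phi>_def P_add[OF obal_G] P_src_left[OF obal_G] P_one[OF obal_G] G mult_additive_sums)

lemma \<phi>_tgt_right: "\<phi> (X \<cdot> t b) = P X (\<lambda>x y. G x (s b \<cdot> y))"
  by (simp add: \<phi>_def P_tgt_right[OF obal_G])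

text \<open>
  The components \<open>Y\<^sub>+\<^sub>2\<close> and \<open>Y\<^sub>-\<^sub>2\<close> meet in the product \<open>m (X Y\<^sub>+) Y\<^sub>-\<close> and cancel by \<open>P_cop_both\<close>.
\<close>

lemma P_m: "P Y (\<lambda>y y'. m (X \<cdot> y) y') = P Y (\<lambda>y y'. S X (\<lambda>x x'. s (G (x \<cdot> y) y') \<cdot> x'))"
proof -
  define F where "F p c z = S X (\<lambda>x x'. s (G (x \<cdot> p) c) \<cdot> (x' \<cdot> z))" for p c z
  have F1: "dbal (\<lambda>x z. F x c z)" for c
  proof (rule balancedI)
    fix b p z
    have "dbal (\<lambda>x x'. s (G (x \<cdot> p) c) \<cdot> (x' \<cdot> z))" by (simp add: balanced_def G)
    from S_takeuchi[OF this, of X b] show "F (t b \<cdot> p) c z = F p c (s b \<cdot> z)" by (simp add: F_def)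
  qed (simp_all add: F_def G cop_sum_distrib)
  have F2: "obal (\<lambda>x c. F x c z)" for z
    by (rule balancedI) (simp_all add: F_def G cop_sum_distrib)
  have d: "dbal (\<lambda>a a'. S y' (\<lambda>c c'. s (G a c) \<cdot> (a' \<cdot> c')))" for y'
    by (intro balanced_cop_sum) (simp add: balanced_def G)
  have "m (X \<cdot> y) y' = S y (\<lambda>p q. S y' (\<lambda>p' q'. F p p' (q \<cdot> q')))" for y y'
  proof -
    have "m (X \<cdot> y) y' = S X (\<lambda>x x'. S y (\<lambda>p q. S y' (\<lambda>c c'. s (G (x \<cdot> p) c) \<cdot> (x' \<cdot> (q \<cdot> c')))))"
      by (simp add: m_S2 S2_swap S_mult[OF d])
    also have "\<dots> = S y (\<lambda>p q. S X (\<lambda>x x'. S y' (\<lambda>c c'. s (G (x \<cdot> p) c) \<cdot> (x' \<cdot> (q \<cdot> c')))))"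
      by (rule cop_sum_swap)
    also have "\<dots> = S y (\<lambda>p q. S y' (\<lambda>p' q'. F p p' (q \<cdot> q')))"
      unfolding F_def by (intro cop_sum_cong cop_sum_swap)
    finally show ?thesis .
  qed
  then have "P Y (\<lambda>y y'. m (X \<cdot> y) y') = P Y (\<lambda>y y'. S y (\<lambda>p q. S y' (\<lambda>p' q'. F p p' (q \<cdot> q'))))"
    by simp
  also have "\<dots> = P Y (\<lambda>x y. F x y \<^bold>1)" by (rule P_cop_both[OF F1 F2])
  finally show ?thesis by (simp add: F_def)
qed

lemma P_m_eq_\<phi>: "P Y m = s (\<phi> Y)"
proof -
  have "dbal (\<lambda>x x'. s (G (x \<cdot> y) y') \<cdot> x')" for y y'
    by (simp add: balanced_def G)
  with P_m[of Y "\<^bold>1"] show ?thesis by (simp add: S_one \<phi>_def mult_additive_sums)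
qed

section \<open>The map \<open>\<Psi>\<close>\<close>

abbreviation \<Psi> where "\<Psi> \<equiv> Psi L G"

lemma dbal_\<Psi>: "dbal (\<lambda>x y. t (\<phi> y) \<cdot> x)"
  by (simp add: balanced_def)

lemma \<Psi>: "\<Psi> X = S X (\<lambda>x y. t (\<phi> y) \<cdot> x)"
  unfolding Psi_def \<phi>_def mult_additive_sums by (simp add: cop_sum_def pm_sum_def)

lemma \<Psi>_linear [simp]:
  "\<Psi> (X + Y) = \<Psi> X + \<Psi> Y" "\<Psi> (s a \<cdot> X) = s a \<cdot> \<Psi> X" "\<Psi> (t a \<cdot> X) = t a \<cdot> \<Psi> X" "\<Psi> \<^bold>1 = \<^bold>1"
  by (simp_all add: \<Psi> S_add[OF dbal_\<Psi>] S_src_left[OF dbal_\<Psi>] S_tgt_left[OF dbal_\<Psi>] S_one[OF dbal_\<Psi>]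
      mult_additive_sums tgt_src_left)

lemma \<Psi>_sums: "\<Psi> (S X f) = S X (\<lambda>x y. \<Psi> (f x y))" "\<Psi> (P X f) = P X (\<lambda>x y. \<Psi> (f x y))"
  using cop_sum_additive[of \<Psi> L X f] pm_sum_additive[of \<Psi> L X f] by simp_all

lemma cou_\<Psi>: "e (\<Psi> X) = \<phi> X"
proof -
  have "e (\<Psi> X) = S X (\<lambda>x y. \<phi> (s (e x) \<cdot> y))"
    using cop_sum_additive[of e L X "\<lambda>x y. t (\<phi> y) \<cdot> x"] by (simp add: \<Psi>)
  then show ?thesis by (simp only: S_counit_left[of \<phi>] \<phi>(1))
qed

text \<open>
  By coassociativity, as \<open>\<Delta>(t(b) X) = X\<^sub>1 \<diamondop> t(b) X\<^sub>2\<close> leaves the first factor alone.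
\<close>

lemma S_\<Psi>:
  assumes "dbal f"
  shows "S (\<Psi> X) f = S X (\<lambda>x y. f x (\<Psi> y))"
proof -
  have "S (\<Psi> X) f = S X (\<lambda>w z. S (t (\<phi> z) \<cdot> w) f)"
    using cop_sum_additive[of "\<lambda>x. S x f" L X] by (simp add: \<Psi> S_add[OF assms])
  also have "\<dots> = S X (\<lambda>w z. S w (\<lambda>x y. f x (t (\<phi> z) \<cdot> y)))"
    by (simp add: S_tgt_left[OF assms])
  also have "\<dots> = S X (\<lambda>x w. S w (\<lambda>y z. f x (t (\<phi> z) \<cdot> y)))"
    by (rule S_coassoc) (use assms in \<open>simp_all add: balanced_def tgt_src_left\<close>)
  also have "\<dots> = S X (\<lambda>x w. f x (\<Psi> w))"
  proof -
    have "S w (\<lambda>y z. f x (t (\<phi> z) \<cdot> y)) = f x (\<Psi> w)" for x w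
      using cop_sum_additive[of "f x" L w "\<lambda>x y. t (\<phi> y) \<cdot> x"] assms
      by (simp add: \<Psi> balanced_def)
    then show ?thesis by simp
  qed
  finally show ?thesis .
qed

text \<open>
  Expanding \<open>\<Gamma>(X Y\<^sub>+, Y\<^sub>-)\<close> by \<open>G_mult_left\<close> leaves \<open>m Y\<^sub>2\<^sub>+ Y\<^sub>2\<^sub>- = s(\<phi>(Y\<^sub>2))\<close> in the second argument of \<open>\<Gamma>\<close>.
  On \<open>s(b)\<close>, \<open>\<Gamma>\<close> is given by the counit, so that only \<open>\<Gamma>\<^sup>-\<^sup>1\<close> survives.
\<close>

lemma P_G_eq: "P Y (\<lambda>y y'. G (X \<cdot> y) y') = G' X (\<Psi> Y)"
proof -
  define F where "F y1 y2 y' = S X (\<lambda>x x'. G' x y1 \<star> G x' (m y2 y'))" for y1 y2 y'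
  have "dbal2 (\<lambda>x y1 x' y2. G' x y1 \<star> G x' (m y2 y'))" for y'
    by (simp add: dbal2_def balanced_def G m_linear)
  then have F1: "dbal (\<lambda>y1 y2. F y1 y2 y')" for y'
    unfolding F_def by (rule dbal2_S)
  have F2: "obal (F y1)" for y1
    by (rule balancedI) (simp_all add: F_def G m_linear cop_sum_distrib)
  have "P Y (\<lambda>y y'. G (X \<cdot> y) y') = P Y (\<lambda>y y'. S y (\<lambda>y1 y2. F y1 y2 y'))"
    by (simp add: G_mult_left S2_def F_def)
  also have "\<dots> = S Y (\<lambda>y1 w. P w (F y1))"
    by (rule P_cop_plus[OF F1 F2])
  also have "\<dots> = S Y (\<lambda>y1 w. G' X (t (\<phi> w) \<cdot> y1))"
  proof (rule cop_sum_cong)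
    fix y1 w
    have "P w (F y1) = S X (\<lambda>x x'. G' x y1 \<star> e (x' \<cdot> s (\<phi> w)))"
      unfolding F_def cop_pm_sum_swap[symmetric]
      by (simp flip: mult_additive_sums G_sums G_src add: P_m_eq_\<phi>)
    also have "\<dots> = S X (\<lambda>x x'. G' (t (e x') \<cdot> x) (t (\<phi> w) \<cdot> y1))"
      using S_takeuchi[of "\<lambda>x x'. G' x y1 \<star> e x'" X "\<phi> w"] by (simp add: balanced_def G)
    also have "\<dots> = G' X (t (\<phi> w) \<cdot> y1)"
      by (rule S_counit_right) (simp add: G)
    finally show "P w (F y1) = G' X (t (\<phi> w) \<cdot> y1)" .
  qed
  also have "\<dots> = G' X (\<Psi> Y)" by (simp add: \<Psi> G_sums)
  finally show ?thesis .
qed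

section \<open>Multiplicativity of \<open>\<Psi>\<close>\<close>

text \<open>
  Since \<open>\<phi>(Z t(b)) = \<Gamma>(Z\<^sub>+, s(b) Z\<^sub>-)\<close>, the left-hand side is
  \<open>\<Gamma>(X\<^sub>+\<^sub>+ Y\<^sub>+\<^sub>+, s(\<Gamma>(Y\<^sub>-, X\<^sub>-)) Y\<^sub>+\<^sub>- X\<^sub>+\<^sub>-)\<close>.  Two applications of \<open>P_cop_minus\<close> make this
  \<open>\<Gamma>(X\<^sub>+ Y\<^sub>+, m Y\<^sub>- X\<^sub>-)\<close>, and the cocycle identity \<open>\<Gamma>(m (X\<^sub>+ Y\<^sub>+) Y\<^sub>-, X\<^sub>-)\<close>.  Here \<open>P_m\<close> and
  \<open>P_G_eq\<close> remove the sum over \<open>Y\<^sub>+ \<otimes> Y\<^sub>-\<close>, and \<open>P_cop_plus\<close> leaves \<open>\<Gamma>\<^sup>-\<^sup>1(X\<^sub>1, \<Psi>(Y)) \<star> \<phi>(X\<^sub>2)\<close>.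
\<close>

lemma \<phi>_twisted:
  "P X (\<lambda>x x'. P Y (\<lambda>y y'. \<phi> (x \<cdot> (y \<cdot> t (G y' x'))))) = G' (\<Psi> X) (\<Psi> Y)"
proof -
  define H where "H p x' p' = P Y (\<lambda>q y. S y (\<lambda>y' q'. G (p \<cdot> q) (s (G y' x') \<cdot> (q' \<cdot> p'))))" for p x' p'
  have obal_mult: "obal (\<lambda>p p'. G p (s b \<cdot> p'))" for b
    by (simp add: balanced_def G tgt_src_left)
  have inner: "P Y (\<lambda>y y'. P y (\<lambda>q q'. G (p \<cdot> q) (s (G y' x') \<cdot> (q' \<cdot> p')))) = H p x' p'" for p x' p'
    unfolding H_def by (rule P_cop_minus[symmetric]) (simp_all add: balanced_def G tgt_src_left)
  have "P Y (\<lambda>y y'. \<phi> (x \<cdot> (y \<cdot> t (G y' x')))) = P x (\<lambda>p p'. H p x' p')" for x x'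
  proof -
    have "\<phi> (x \<cdot> (y \<cdot> t (G y' x'))) = P x (\<lambda>p p'. P y (\<lambda>q q'. G (p \<cdot> q) (s (G y' x') \<cdot> (q' \<cdot> p'))))" for y y'
      using \<phi>_tgt_right[of "x \<cdot> y" "G y' x'"] by (simp add: P_mult[OF obal_mult])
    then show ?thesis by (simp only: pm_sum_swap[of L Y x] inner)
  qed
  then have "P X (\<lambda>x x'. P Y (\<lambda>y y'. \<phi> (x \<cdot> (y \<cdot> t (G y' x'))))) = P X (\<lambda>x x'. P x (\<lambda>p p'. H p x' p'))"
    by simp
  also have "\<dots> = P X (\<lambda>p x. S x (H p))"
  proof (rule P_cop_minus[symmetric])
    show "dbal (H p)" for p
    proof (rule balancedI)
      fix b x' p'
      have d: "dbal (\<lambda>y' q'. G (p \<cdot> q) (s (G y' x') \<cdot> (q' \<cdot> p')))" for q x' p'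
        by (simp add: balanced_def G)
      show "H p (t b \<cdot> x') p' = H p x' (s b \<cdot> p')"
        using S_takeuchi[OF d] by (simp add: H_def G)
    qed (simp_all add: H_def G cop_sum_distrib pm_sum_distrib)
    show "obal (\<lambda>p p'. H p x' p')" for x'
    proof (rule balancedI)
      fix b p p'
      have d: "dbal (\<lambda>y' q'. G (p \<cdot> q) (s (G y' x') \<cdot> (q' \<cdot> p')))" for q x' p'
        by (simp add: balanced_def G)
      have "obal (\<lambda>q y. S y (\<lambda>y' q'. G (p \<cdot> q) (s (G y' x') \<cdot> (q' \<cdot> p'))))" for p'
        by (rule balancedI) (simp_all add: G S_add[OF d] S_tgt_left[OF d] tgt_src_left cop_sum_distrib)
      from P_takeuchi[OF this] show "H (p \<cdot> t b) x' p' = H p x' (t b \<cdot> p')"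
        by (simp add: H_def S_tgt_right[OF d])
    qed (simp_all add: H_def G cop_sum_distrib pm_sum_distrib)
  qed
  also have "\<dots> = P X (\<lambda>p x. P Y (\<lambda>q y. G (p \<cdot> q) (m y x)))"
  proof (rule pm_sum_cong)
    fix p x
    have "S x (H p) = P Y (\<lambda>q y. S x (\<lambda>x' p'. S y (\<lambda>y' q'. G (p \<cdot> q) (s (G y' x') \<cdot> (q' \<cdot> p')))))"
      unfolding H_def by (rule cop_pm_sum_swap)
    also have "\<dots> = P Y (\<lambda>q y. G (p \<cdot> q) (m y x))"
      by (simp add: m_S2 S2_def G_sums)
    finally show "S x (H p) = \<dots>" .
  qed
  also have "\<dots> = P X (\<lambda>p x. G (P Y (\<lambda>q y. m (p \<cdot> q) y)) x)"
    by (simp add: G_m G_sums)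
  also have "\<dots> = P X (\<lambda>p x. S p (\<lambda>p1 p2. P Y (\<lambda>q y. G (p1 \<cdot> q) y) \<star> G p2 x))"
    by (simp add: P_m G_sums G pm_cop_sum_swap mult_additive_sums)
  also have "\<dots> = P X (\<lambda>p x. S p (\<lambda>p1 p2. G' p1 (\<Psi> Y) \<star> G p2 x))"
    by (simp add: P_G_eq)
  also have "\<dots> = S X (\<lambda>p1 w. P w (\<lambda>p2 x. G' p1 (\<Psi> Y) \<star> G p2 x))"
    by (rule P_cop_plus) (simp_all add: balanced_def G)
  also have "\<dots> = S X (\<lambda>p1 w. G' (t (\<phi> w) \<cdot> p1) (\<Psi> Y))"
    by (simp add: \<phi>_def G_sums mult_additive_sums) (simp add: G)
  also have "\<dots> = G' (\<Psi> X) (\<Psi> Y)"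
    by (simp add: \<Psi>[of X] G_sums)
  finally show ?thesis .
qed

text \<open>
  The product of the cotwist without its factor \<open>\<Gamma>(X\<^sub>1, Y\<^sub>1)\<close>.
\<close>

definition right_twisted where "right_twisted X Y = P X (\<lambda>x x'. P Y (\<lambda>y y'. x \<cdot> (y \<cdot> t (G y' x'))))"

lemma cotwist_mult_S2: "cotwist_mult L G X Y = S2 X Y (\<lambda>x y x' y'. s (G x y) \<cdot> right_twisted x' y')"
  unfolding S2_swap right_twisted_def mult_additive_sums
  by (simp add: cotwist_mult_def cop_sum_def pm_sum_def)

lemma right_twisted_obal_right: "obal (\<lambda>y y'. x \<cdot> (y \<cdot> t (G y' x')))"
  by (simp add: balanced_def G)

lemma right_twisted_obal_left: "obal (\<lambda>x x'. P Y (\<lambda>y y'. x \<cdot> (y \<cdot> t (G y' x'))))"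
proof (rule balancedI)
  fix b x x'
  show "P Y (\<lambda>y y'. x \<cdot> t b \<cdot> (y \<cdot> t (G y' x'))) = P Y (\<lambda>y y'. x \<cdot> (y \<cdot> t (G y' (t b \<cdot> x'))))"
    using P_takeuchi[OF right_twisted_obal_right[of x x'], of Y b] by (simp add: G)
qed (simp_all add: G pm_sum_distrib)

lemma right_twisted_linear:
  "right_twisted (X + X') Y = right_twisted X Y + right_twisted X' Y" "right_twisted (s a \<cdot> X) Y = s a \<cdot> right_twisted X Y"
  "right_twisted \<^bold>1 Y = Y" "right_twisted (t a) Y = t a \<cdot> Y"
proof -
  show "right_twisted (X + X') Y = right_twisted X Y + right_twisted X' Y" "right_twisted (s a \<cdot> X) Y = s a \<cdot> right_twisted X Y"
    by (simp_all add: right_twisted_def P_add[OF right_twisted_obal_left] P_src_left[OF right_twisted_obal_left] mult_additive_sums)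
  show "right_twisted \<^bold>1 Y = Y"
    using P_counit[of "\<lambda>x. x" Y] by (simp add: right_twisted_def P_one[OF right_twisted_obal_left])
  have "right_twisted (t a) Y = P Y (\<lambda>y y'. y \<cdot> t (e (y' \<cdot> t a)))"
    using P_tgt_left[OF right_twisted_obal_left, of a "\<^bold>1" Y] P_one[OF obal_mult_right[OF right_twisted_obal_left[of Y], of "s a"]]
    by (simp add: right_twisted_def G_src cou_src_tgt)
  also have "\<dots> = P Y (\<lambda>y y'. t a \<cdot> y \<cdot> t (e y'))"
    by (rule P_takeuchi[symmetric]) (simp add: balanced_def)
  also have "\<dots> = t a \<cdot> Y"
    using P_counit[of "\<lambda>x. x" Y] by (simp flip: mult_additive_sums)
  finally show "right_twisted (t a) Y = t a \<cdot> Y" .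
qed

text \<open>
  The coproduct of \<open>X\<^sub>+ Y\<^sub>+ t(\<Gamma>(Y\<^sub>-, X\<^sub>-))\<close> is \<open>X\<^sub>1 Y\<^sub>1 \<diamondop> X\<^sub>2\<^sub>+ Y\<^sub>2\<^sub>+ t(\<Gamma>(Y\<^sub>2\<^sub>-, X\<^sub>2\<^sub>-))\<close> by \<open>P_cop_plus\<close>,
  and \<open>\<phi>\<close> of the second factor is known from \<open>\<phi>_twisted\<close>.
\<close>

lemma \<Psi>_right_twisted: "\<Psi> (right_twisted X Y) = S2 X Y (\<lambda>x y x' y'. t (G' (\<Psi> x') (\<Psi> y')) \<cdot> (x \<cdot> y))"
proof -
  define F where "F x1 x2 x' y1 y2 y' = t (\<phi> (x2 \<cdot> (y2 \<cdot> t (G y' x')))) \<cdot> (x1 \<cdot> y1)" for x1 x2 x' y1 y2 y'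
  have Fx: "dbal (\<lambda>x1 x2. F x1 x2 x' y1 y2 y')" for x' y1 y2 y'
    by (simp add: F_def balanced_def)
  \<comment> \<open>The summand is balanced in \<open>y1\<close>, \<open>y2\<close> only with the sum over \<open>\<Delta>(x)\<close> inside.\<close>
  have F1: "dbal (\<lambda>y1 y2. S x (\<lambda>x1 x2. F x1 x2 x' y1 y2 y'))" for x x' y'
    using S_takeuchi[OF Fx]
    by (intro balancedI) (simp_all add: F_def cop_sum_distrib)
  have F2: "obal (\<lambda>y2 y'. S x (\<lambda>x1 x2. F x1 x2 x' y1 y2 y'))" for x x' y1
    by (intro balanced_cop_sum) (simp add: F_def balanced_def G)
  have F3: "dbal (\<lambda>x1 x2. P w (\<lambda>y2 y'. F x1 x2 x' y1 y2 y'))" for x' y1 w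
    by (intro balanced_pm_sum Fx)
  have F4: "obal (\<lambda>x2 x'. P w (\<lambda>y2 y'. F x1 x2 x' y1 y2 y'))" for x1 y1 w
  proof (rule balancedI)
    fix b x2 x'
    have "obal (\<lambda>y2 y'. F x1 x2 x' y1 y2 y')"
      by (simp add: F_def balanced_def G)
    from P_takeuchi[OF this, of w b]
    show "P w (F x1 (x2 \<cdot> t b) x' y1) = P w (F x1 x2 (t b \<cdot> x') y1)"
      by (simp add: F_def[abs_def] G)
  qed (simp_all add: F_def G pm_sum_distrib)
  have "\<Psi> (x \<cdot> (y \<cdot> t (G y' x'))) = S y (\<lambda>y1 y2. S x (\<lambda>x1 x2. F x1 x2 x' y1 y2 y'))" for x x' y y'
  proof -
    have d: "dbal (\<lambda>z1 z2. t (\<phi> (z2 \<cdot> t b)) \<cdot> z1)" for b by (simp add: balanced_def)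
    have "\<Psi> (x \<cdot> (y \<cdot> t (G y' x'))) = S (x \<cdot> y) (\<lambda>z1 z2. t (\<phi> (z2 \<cdot> t (G y' x'))) \<cdot> z1)"
      using S_tgt_right[OF dbal_\<Psi>, of "x \<cdot> y" "G y' x'"] by (simp add: \<Psi>)
    also have "\<dots> = S x (\<lambda>x1 x2. S y (\<lambda>y1 y2. F x1 x2 x' y1 y2 y'))"
      by (simp add: S_mult[OF d] F_def)
    finally show ?thesis by (simp only: cop_sum_swap[of L x])
  qed
  then have "\<Psi> (right_twisted X Y) = P X (\<lambda>x x'. P Y (\<lambda>y y'. S y (\<lambda>y1 y2. S x (\<lambda>x1 x2. F x1 x2 x' y1 y2 y'))))"
    by (simp add: right_twisted_def \<Psi>_sums)
  also have "\<dots> = P X (\<lambda>x x'. S Y (\<lambda>y1 w. P w (\<lambda>y2 y'. S x (\<lambda>x1 x2. F x1 x2 x' y1 y2 y'))))"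
    by (intro pm_sum_cong P_cop_plus F1 F2)
  also have "\<dots> = S Y (\<lambda>y1 w. P X (\<lambda>x x'. S x (\<lambda>x1 x2. P w (\<lambda>y2 y'. F x1 x2 x' y1 y2 y'))))"
    by (subst pm_cop_sum_swap) (intro cop_sum_cong pm_sum_cong pm_cop_sum_swap)
  also have "\<dots> = S Y (\<lambda>y1 w. S X (\<lambda>x1 v. P v (\<lambda>x2 x'. P w (\<lambda>y2 y'. F x1 x2 x' y1 y2 y'))))"
    by (intro cop_sum_cong P_cop_plus F3 F4)
  also have "\<dots> = S2 X Y (\<lambda>x y x' y'. t (G' (\<Psi> x') (\<Psi> y')) \<cdot> (x \<cdot> y))"
    unfolding S2_def by (simp add: F_def mult_additive_sums flip: \<phi>_twisted)
  finally show ?thesis .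
qed

abbreviation drinfeld_mult where "drinfeld_mult \<equiv> amult (drinfeld_cotwist L G G')"

lemma drinfeld_mult_S2: "drinfeld_mult X Y =
  S2 X Y (\<lambda>x1 y1 x y. S2 x y (\<lambda>x2 y2 x3 y3. s (G x1 y1) \<cdot> (t (G' x3 y3) \<cdot> (x2 \<cdot> y2))))"
proof -
  have sum3: "(\<Sum>(x, y, z)\<in>#sw3 L X. f x y z) = S X (\<lambda>x w. S w (\<lambda>y z. f x y z))"
    for X and f :: "'l \<Rightarrow> 'l \<Rightarrow> 'l \<Rightarrow> 'l"
    by (simp add: sw3_def cop_sum_def case_prod_unfold sum_mset_sum_mset image_mset.compositionality comp_def)
  have "drinfeld_mult X Y = S X (\<lambda>x1 x. S x (\<lambda>x2 x3. S Y (\<lambda>y1 y. S y (\<lambda>y2 y3.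
      s (G x1 y1) \<cdot> (t (G' x3 y3) \<cdot> (x2 \<cdot> y2))))))"
    by (simp add: drinfeld_cotwist_def sum3)
  also have "\<dots> = S X (\<lambda>x1 x. S Y (\<lambda>y1 y. S x (\<lambda>x2 x3. S y (\<lambda>y2 y3.
      s (G x1 y1) \<cdot> (t (G' x3 y3) \<cdot> (x2 \<cdot> y2))))))"
    by (intro cop_sum_cong cop_sum_swap)
  finally show ?thesis by (simp add: S2_swap)
qed

lemma S2_\<Psi>:
  assumes "dbal2 f"
  shows "S2 (\<Psi> X) (\<Psi> Y) f = S2 X Y (\<lambda>x y x' y'. f x y (\<Psi> x') (\<Psi> y'))"
  unfolding S2_def by (subst S_\<Psi>[OF dbal2_S[OF assms]]) (simp only: S_\<Psi>[OF dbal2_left[OF assms]])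

lemma dbal2_drinfeld:
  "dbal2 (\<lambda>x1 y1 x y. S2 x y (\<lambda>x2 y2 x3 y3. s (G x1 y1) \<cdot> (t (G' x3 y3) \<cdot> (x2 \<cdot> y2))))"
proof -
  define W where "W x y = S2 x y (\<lambda>x2 y2 x3 y3. t (G' x3 y3) \<cdot> (x2 \<cdot> y2))" for x y
  have d: "dbal2 (\<lambda>x2 y2 x3 y3. t (G' x3 y3) \<cdot> (x2 \<cdot> y2))"
    by (simp add: dbal2_def balanced_def G)
  note dl = dbal2_left[OF d] and dr = dbal2_S[OF d]
  have W: "W (x + x') y = W x y + W x' y" "W x (y + y') = W x y + W x y'"
    "W (s b \<cdot> x) y = s b \<cdot> W x y" "W x (s b \<cdot> y) = W (x \<cdot> s b) y" for x x' y y' b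
    by (simp_all add: W_def S2_def S_add[OF dl] S_add[OF dr] S_src_left[OF dl] S_src_left[OF dr]
        S_src_right[OF dl] cop_sum_distrib mult_additive_sums tgt_src_left)
  have FW: "S2 x y (\<lambda>x2 y2 x3 y3. s (G x1 y1) \<cdot> (t (G' x3 y3) \<cdot> (x2 \<cdot> y2))) = s (G x1 y1) \<cdot> W x y"
    for x1 y1 x y
    by (simp add: W_def S2_def mult_additive_sums)
  show ?thesis
    unfolding FW by (simp add: dbal2_def balanced_def W G)
qed

lemma \<Psi>_mult: "\<Psi> (cotwist_mult L G X Y) = drinfeld_mult (\<Psi> X) (\<Psi> Y)"
proof -
  define F where "F x1 y1 x2 y2 x3 y3 = s (G x1 y1) \<cdot> (t (G' x3 y3) \<cdot> (x2 \<cdot> y2))" for x1 y1 x2 y2 x3 y3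
  have 1: "dbal2 (F x1 y1)" for x1 y1
    by (simp add: F_def dbal2_def balanced_def G)
  have 2: "dbal2 (\<lambda>x1 y1 x y. S2 x y (F x1 y1))"
    using dbal2_drinfeld by (simp add: F_def[abs_def])
  have "\<Psi> (cotwist_mult L G X Y) = S2 X Y (\<lambda>x1 y1 x y. s (G x1 y1) \<cdot> \<Psi> (right_twisted x y))"
    by (simp add: cotwist_mult_S2 S2_def \<Psi>_sums)
  also have "\<dots> = S2 X Y (\<lambda>x1 y1 x y. S2 x y (\<lambda>x2 y2 x3 y3. F x1 y1 x2 y2 (\<Psi> x3) (\<Psi> y3)))"
    by (simp add: \<Psi>_right_twisted F_def S2_def mult_additive_sums)
  also have "\<dots> = S2 X Y (\<lambda>x1 y1 x y. S2 (\<Psi> x) (\<Psi> y) (F x1 y1))"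
    by (simp only: S2_\<Psi>[OF 1])
  also have "\<dots> = S2 (\<Psi> X) (\<Psi> Y) (\<lambda>x1 y1 x y. S2 x y (F x1 y1))"
    by (rule S2_\<Psi>[OF 2, symmetric])
  also have "\<dots> = drinfeld_mult (\<Psi> X) (\<Psi> Y)"
    by (simp add: drinfeld_mult_S2 F_def[abs_def])
  finally show ?thesis .
qed

section \<open>The inverse of \<open>\<Psi>\<close>\<close>

abbreviation \<Phi> where "\<Phi> \<equiv> Psi_inv L G'"

definition \<Phi>' where "\<Phi>' x y = P x (\<lambda>p q. p \<cdot> t (G' q y))"

lemma obal_\<Phi>: "obal (\<lambda>p q. p \<cdot> t (G' q y))"
  by (simp add: balanced_def G)

lemma dbal_\<Phi>: "dbal \<Phi>'"
  unfolding \<Phi>'_def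
  by (rule balancedI) (simp_all add: P_add[OF obal_\<Phi>] P_tgt_left[OF obal_\<Phi>] G pm_sum_distrib)

lemma \<Phi>: "\<Phi> X = S X \<Phi>'"
  by (simp add: Psi_inv_def \<Phi>'_def[abs_def] cop_sum_def pm_sum_def)

text \<open>
  By \<open>P_G_eq\<close>, \<open>\<Gamma>\<^sup>-\<^sup>1(X\<^sub>1\<^sub>-, \<Psi>(X\<^sub>2)) = \<Gamma>(X\<^sub>1\<^sub>- X\<^sub>2\<^sub>+, X\<^sub>2\<^sub>-)\<close>; with \<open>P_cop_plus\<close> the first argument of \<open>\<Gamma>\<close> has the
  form of \<open>S_P_cancel\<close>, and \<open>X\<^sub>+ t(\<Gamma>(1, X\<^sub>-)) = X\<close> remains.
\<close>

lemma \<Phi>_\<Psi>: "\<Phi> (\<Psi> X) = X"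
proof -
  define F where "F x r r' = P x (\<lambda>p q. p \<cdot> t (G (q \<cdot> r) r'))" for x r r'
  have o: "obal (\<lambda>p q. p \<cdot> t (G (q \<cdot> r) r'))" for r r'
    by (simp add: balanced_def G)
  have F1: "dbal (\<lambda>x r. F x r r')" for r'
    unfolding F_def by (rule balancedI) (simp_all add: P_add[OF o] P_tgt_left[OF o] G pm_sum_distrib)
  have F2: "obal (F x)" for x
    by (rule balancedI) (simp_all add: F_def G pm_sum_distrib)
  have "\<Phi> (\<Psi> X) = S X (\<lambda>x y. P x (\<lambda>p q. p \<cdot> t (G' q (\<Psi> y))))"
    by (simp add: \<Phi> S_\<Psi>[OF dbal_\<Phi>] \<Phi>'_def)
  also have "\<dots> = S X (\<lambda>x y. P x (\<lambda>p q. P y (\<lambda>r r'. p \<cdot> t (G (q \<cdot> r) r'))))"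
    by (simp add: mult_additive_sums flip: P_G_eq)
  also have "\<dots> = S X (\<lambda>x y. P y (F x))"
    unfolding F_def by (intro cop_sum_cong pm_sum_swap)
  also have "\<dots> = P X (\<lambda>w r'. S w (\<lambda>x r. F x r r'))"
    by (rule P_cop_plus[OF F1 F2, symmetric])
  also have "\<dots> = P X (\<lambda>w r'. w \<cdot> t (e r'))"
  proof (rule pm_sum_cong)
    fix w r'
    have "obal (\<lambda>p q. p \<cdot> t (G q r'))" by (simp add: balanced_def G)
    from S_P_cancel[OF this, of w] show "S w (\<lambda>x r. F x r r') = w \<cdot> t (e r')"
      by (simp add: F_def)
  qed
  also have "\<dots> = X" by (rule P_counit) simp
  finally show ?thesis .
qed

text \<open>
  The expression \<open>\<Gamma>(w\<^sub>+, s(\<Gamma>\<^sup>-\<^sup>1(w\<^sub>-\<^sub>1, y)) w\<^sub>-\<^sub>2)\<close>, which appears as the argument of \<open>t\<close> in \<open>\<Psi>(\<Psi>\<^sup>-\<^sup>1(X))\<close>.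
\<close>

definition N where "N w y = P w (\<lambda>r z. S z (\<lambda>q r'. G r (s (G' q y) \<cdot> r')))"

lemma dbal_N: "dbal (\<lambda>q r'. G r (s (G' q y) \<cdot> r'))"
  by (simp add: balanced_def G)

lemma obal_N: "obal (\<lambda>r z. S z (\<lambda>q r'. G r (s (G' q y) \<cdot> r')))"
  by (rule balancedI)
    (simp_all add: G S_add[OF dbal_N] S_tgt_left[OF dbal_N] tgt_src_left cop_sum_distrib)

text \<open>
  In the last equation, \<open>a\<close> moves from \<open>y\<close> to \<open>w\<^sub>-\<^sub>1\<close>, by the Takeuchi condition to the right of \<open>w\<^sub>-\<^sub>2\<close> as
  \<open>s(a)\<close>, which may be replaced by \<open>t(a)\<close>, and with \<open>P_takeuchi\<close> to the left of \<open>w\<^sub>+\<close>.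
\<close>

lemma N_linear:
  "N (w + w') y = N w y + N w' y" "N w (y + y') = N w y + N w y'"
  "N (s a \<cdot> w) y = a \<star> N w y" "N (t a \<cdot> w) y = N w (s a \<cdot> y)" "N w (t a \<cdot> y) = N w y \<star> a"
proof -
  show "N (w + w') y = N w y + N w' y" "N w (y + y') = N w y + N w y'" "N (s a \<cdot> w) y = a \<star> N w y"
    by (simp_all add: N_def P_add[OF obal_N] P_src_left[OF obal_N] G cop_sum_distrib pm_sum_distrib
        mult_additive_sums)
  show "N (t a \<cdot> w) y = N w (s a \<cdot> y)"
    by (simp add: N_def P_tgt_left[OF obal_N] S_src_right[OF dbal_N] G)
  have "N w (t a \<cdot> y) = P w (\<lambda>r z. S z (\<lambda>q r'. G r (s (G' q y) \<cdot> (r' \<cdot> s a))))"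
    using S_takeuchi[OF dbal_N] by (simp add: N_def G)
  also have "\<dots> = P w (\<lambda>r z. S (z \<cdot> t a) (\<lambda>q r'. G r (s (G' q y) \<cdot> r')))"
    using G_src_tgt[of _ "s b \<cdot> r'" a for b r'] by (simp add: S_tgt_right[OF dbal_N])
  also have "\<dots> = P w (\<lambda>r z. S z (\<lambda>q r'. G (t a \<cdot> r) (s (G' q y) \<cdot> r')))"
    by (rule P_takeuchi[OF obal_N, symmetric])
  also have "\<dots> = N w y \<star> a"
    by (simp add: N_def G mult_additive_sums)
  finally show "N w (t a \<cdot> y) = N w y \<star> a" .
qed

text \<open>
  Expanding \<open>\<epsilon>(Y) = \<Gamma>(Y\<^sub>1\<^sub>+, Y\<^sub>1\<^sub>- Y\<^sub>2)\<close> by \<open>G_mult_right\<close>, the last factor is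
  \<open>\<Gamma>(Y\<^sub>1\<^sub>+\<^sub>2 Y\<^sub>1\<^sub>-\<^sub>3, Y\<^sub>3)\<close>.  By \<open>P_cop_both\<close> it becomes \<open>\<epsilon>(Y\<^sub>3)\<close>, which the last equation of \<open>N_linear\<close>
  moves to \<open>Y\<^sub>2\<close>, where it disappears.
\<close>

lemma S_N: "S Y N = e Y"
proof -
  have "e Y = S Y (\<lambda>w v. P w (\<lambda>r z. G r (z \<cdot> v)))"
    using S_P_cancel[OF obal_G, of Y] by simp
  also have "\<dots> = S Y N"
  proof (rule cop_sum_cong)
    fix w v
    define F where "F z1 z2 r1 b y = S b (\<lambda>q a. G r1 (s (G' q z1) \<cdot> a) \<star> G y z2)" for z1 z2 r1 b y
    have d: "dbal (\<lambda>q a. G r1 (s (G' q z1) \<cdot> a) \<star> G y z2)" for z1 z2 r1 y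
      by (simp add: balanced_def G)
    have F1: "dbal (\<lambda>r1 y. F z1 z2 r1 b y)" for z1 z2 b
      by (simp add: balanced_def F_def G cop_sum_distrib)
    have F2: "obal (\<lambda>r1 b. F z1 z2 r1 b y)" for z1 z2 y
      by (rule balancedI) (simp_all add: F_def G S_add[OF d] S_tgt_left[OF d] tgt_src_left cop_sum_distrib)
    have step: "S z (\<lambda>q z'. S r (\<lambda>r1 r2. S z' (\<lambda>a a'. G r1 (s (G' q z1) \<cdot> a) \<star> G (r2 \<cdot> a') z2))) =
        S r (\<lambda>r1 r2. S z (\<lambda>b a'. F z1 z2 r1 b (r2 \<cdot> a')))" for z r z1 z2
    proof -
      define F' where "F' q a a' = S r (\<lambda>r1 r2. G r1 (s (G' q z1) \<cdot> a) \<star> G (r2 \<cdot> a') z2)" for q a a'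
      have d': "dbal (\<lambda>r1 r2. G r1 c \<star> G (r2 \<cdot> a') z2)" for c a'
        by (simp add: balanced_def G)
      have 1: "dbal (\<lambda>q a. F' q a a')" for a'
        unfolding F'_def by (intro balanced_cop_sum) (simp add: balanced_def G)
      have 2: "dbal (\<lambda>a a'. F' q a a')" for q
      proof (rule balancedI)
        fix b a a'
        show "F' q (t b \<cdot> a) a' = F' q a (s b \<cdot> a')"
          using S_takeuchi[OF d', of r b "s (G' q z1) \<cdot> a" a'] by (simp add: F'_def G tgt_src_left)
      qed (simp_all add: F'_def G cop_sum_distrib)
      have "S z (\<lambda>q z'. S r (\<lambda>r1 r2. S z' (\<lambda>a a'. G r1 (s (G' q z1) \<cdot> a) \<star> G (r2 \<cdot> a') z2))) =
          S z (\<lambda>q z'. S z' (\<lambda>a a'. F' q a a'))"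
        unfolding F'_def by (intro cop_sum_cong cop_sum_swap)
      also have "\<dots> = S z (\<lambda>b a'. S b (\<lambda>q a. F' q a a'))"
        by (rule S_coassoc[OF 1 2, symmetric])
      also have "\<dots> = S z (\<lambda>b a'. S r (\<lambda>r1 r2. F z1 z2 r1 b (r2 \<cdot> a')))"
        unfolding F'_def F_def by (intro cop_sum_cong cop_sum_swap)
      finally show ?thesis by (simp only: cop_sum_swap[of L z r])
    qed
    have "P w (\<lambda>r z. G r (z \<cdot> v)) = P w (\<lambda>r z. S v (\<lambda>z1 z2. S z (\<lambda>q z'. S r (\<lambda>r1 r2. S z' (\<lambda>a a'.
        G r1 (s (G' q z1) \<cdot> a) \<star> G (r2 \<cdot> a') z2)))))"
    proof (rule pm_sum_cong)
      fix r z
      have "G r (z \<cdot> v) = S v (\<lambda>z1 z2. S z (\<lambda>q z'. S z' (\<lambda>a a'. S r (\<lambda>r1 r2.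
        G r1 (s (G' q z1) \<cdot> a) \<star> G (r2 \<cdot> a') z2))))"
        by (simp only: G_mult_right[of r z v] S2_def)
      also have "\<dots> = S v (\<lambda>z1 z2. S z (\<lambda>q z'. S r (\<lambda>r1 r2. S z' (\<lambda>a a'.
        G r1 (s (G' q z1) \<cdot> a) \<star> G (r2 \<cdot> a') z2))))"
        by (intro cop_sum_cong cop_sum_swap)
      finally show "G r (z \<cdot> v) = \<dots>" .
    qed
    also have "\<dots> = S v (\<lambda>z1 z2. P w (\<lambda>r z. S r (\<lambda>r1 r2. S z (\<lambda>b a'. F z1 z2 r1 b (r2 \<cdot> a')))))"
      by (simp only: step pm_cop_sum_swap)
    also have "\<dots> = S v (\<lambda>z1 z2. P w (\<lambda>r z. F z1 z2 r z \<^bold>1))"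
      by (intro cop_sum_cong P_cop_both F1 F2)
    also have "\<dots> = S v (\<lambda>z1 z2. N w (t (e z2) \<cdot> z1))"
      by (simp add: N_linear) (simp add: F_def N_def mult_additive_sums)
    also have "\<dots> = N w v" by (rule S_counit_right) (rule N_linear)
    finally show "P w (\<lambda>r z. G r (z \<cdot> v)) = N w v" .
  qed
  finally show ?thesis by simp
qed

lemma \<Psi>_tgt_right: "\<Psi> (X \<cdot> t b) = S X (\<lambda>x y. t (\<phi> (y \<cdot> t b)) \<cdot> x)"
  by (simp add: \<Psi> S_tgt_right[OF dbal_\<Psi>])

lemma \<Psi>_\<Phi>: "\<Psi> (\<Phi> X) = X"
proof -
  have inner: "P x (\<lambda>p q. \<Psi> (p \<cdot> t (G' q y))) = S x (\<lambda>z w. t (N w y) \<cdot> z)" for x y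
  proof -
    have "P x (\<lambda>p q. \<Psi> (p \<cdot> t (G' q y))) =
        P x (\<lambda>p q. S p (\<lambda>z1 z2. P z2 (\<lambda>r r'. t (G r (s (G' q y) \<cdot> r')) \<cdot> z1)))"
      by (simp add: \<Psi>_tgt_right \<phi>_tgt_right mult_additive_sums)
    also have "\<dots> = S x (\<lambda>z1 w. P w (\<lambda>z2 q. P z2 (\<lambda>r r'. t (G r (s (G' q y) \<cdot> r')) \<cdot> z1)))"
    proof (rule P_cop_plus)
      have o: "obal (\<lambda>r r'. t (G r (s b \<cdot> r')) \<cdot> z)" for b z
        by (simp add: balanced_def G tgt_src_left)
      show "dbal (\<lambda>z1 z2. P z2 (\<lambda>r r'. t (G r (s (G' q y) \<cdot> r')) \<cdot> z1))" for q
        by (rule balancedI) (simp_all add: P_add[OF o] P_src_left[OF o] G pm_sum_distrib)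
      show "obal (\<lambda>z2 q. P z2 (\<lambda>r r'. t (G r (s (G' q y) \<cdot> r')) \<cdot> z1))" for z1
        by (rule balancedI) (simp_all add: P_add[OF o] P_tgt_right[OF o] G pm_sum_distrib)
    qed
    also have "\<dots> = S x (\<lambda>z w. P w (\<lambda>r z'. S z' (\<lambda>q r'. t (G r (s (G' q y) \<cdot> r')) \<cdot> z)))"
      by (intro cop_sum_cong P_cop_minus[symmetric]) (simp_all add: balanced_def G tgt_src_left)
    finally show ?thesis by (simp add: N_def mult_additive_sums)
  qed
  have "\<Psi> (\<Phi> X) = S X (\<lambda>x y. S x (\<lambda>z w. t (N w y) \<cdot> z))"
    by (simp add: \<Phi> \<Phi>'_def[abs_def] \<Psi>_sums inner)
  also have "\<dots> = S X (\<lambda>z v. S v (\<lambda>w y. t (N w y) \<cdot> z))"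
    by (rule S_coassoc) (simp_all add: balanced_def N_linear)
  also have "\<dots> = S X (\<lambda>z v. t (e v) \<cdot> z)"
    by (simp flip: S_N add: mult_additive_sums)
  also have "\<dots> = X" using S_counit_right[of "\<lambda>x. x" X] by simp
  finally show ?thesis .
qed

section \<open>The coproduct of the cotwist\<close>

text \<open>
  The test function \<open>h\<close> composed with the map \<open>X \<diamondop> Y \<mapsto> X\<^sub>+ t(f(X\<^sub>-, Y\<^sub>1)) \<diamondop> Y\<^sub>2\<close>, which is \<open>\<Gamma>\<^sup>#\<close> for \<open>f = \<Gamma>\<close>.
\<close>

definition sharp_pull :: "('l \<Rightarrow> 'l \<Rightarrow> 'b) \<Rightarrow> ('l \<Rightarrow> 'l \<Rightarrow> 'g::ab_group_add) \<Rightarrow> 'l \<Rightarrow> 'l \<Rightarrow> 'g" where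
  "sharp_pull f h X Y = P X (\<lambda>x x'. S Y (\<lambda>y y'. h (x \<cdot> t (f x' y)) y'))"

lemma sharp_pull_obal:
  assumes f: "Be_linear L f" and h: "dbal h"
  shows "obal (\<lambda>x x'. h (x \<cdot> t (f x' y)) z)"
  using h by (simp add: balanced_def Be_linear_simps[OF f])

lemma sharp_pull_dbal_inner:
  assumes f: "Be_linear L f" and h: "dbal h"
  shows "dbal (\<lambda>y y'. P X (\<lambda>x x'. h (x \<cdot> t (f x' y)) y'))"
proof (rule balancedI)
  fix b y y'
  show "P X (\<lambda>x x'. h (x \<cdot> t (f x' (t b \<cdot> y))) y') = P X (\<lambda>x x'. h (x \<cdot> t (f x' y)) (s b \<cdot> y'))"
    using P_takeuchi[OF sharp_pull_obal[OF f h, of y y'], of X b] h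
    by (simp add: balanced_def Be_linear_simps[OF f])
qed (use h in \<open>simp_all add: balanced_def Be_linear_simps[OF f] pm_sum_distrib\<close>)

lemma sharp_pull_swap: "sharp_pull f h X Y = S Y (\<lambda>y y'. P X (\<lambda>x x'. h (x \<cdot> t (f x' y)) y'))"
  unfolding sharp_pull_def by (rule pm_cop_sum_swap)

lemma sharp_pull_dbal:
  assumes f: "Be_linear L f" and h: "dbal h"
  shows "dbal (sharp_pull f h)"
proof (rule balancedI)
  note o = sharp_pull_obal[OF f h] and d = sharp_pull_dbal_inner[OF f h]
  show "sharp_pull f h (X + X') Y = sharp_pull f h X Y + sharp_pull f h X' Y" for X X' Y
    by (simp add: sharp_pull_swap P_add[OF o] cop_sum_distrib)
  show "sharp_pull f h X (Y + Y') = sharp_pull f h X Y + sharp_pull f h X Y'" for X Y Y'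
    by (simp add: sharp_pull_swap S_add[OF d])
  show "sharp_pull f h (t b \<cdot> X) Y = sharp_pull f h X (s b \<cdot> Y)" for b X Y
    by (simp add: sharp_pull_swap P_tgt_left[OF o] S_src_left[OF d] Be_linear_simps[OF f])
qed

text \<open>
  Composing the maps for \<open>g\<close> and \<open>f\<close> gives \<open>X\<^sub>+\<^sub>+ t(g(X\<^sub>-, Y\<^sub>1) \<star> f(X\<^sub>+\<^sub>-, Y\<^sub>2)) \<diamondop> Y\<^sub>3\<close>, and \<open>P_cop_minus\<close> turns
  \<open>X\<^sub>- \<otimes> X\<^sub>+\<^sub>-\<close> into \<open>X\<^sub>-\<^sub>1 \<otimes> X\<^sub>-\<^sub>2\<close>.
\<close>

lemma sharp_pull_comp:
  assumes f: "Be_linear L f" and g: "Be_linear L g" and h: "dbal h"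
  shows "sharp_pull g (sharp_pull f h) X Y = sharp_pull (convolution L g f) h X Y"
proof -
  define H where "H p x' p' = S Y (\<lambda>y w. S w (\<lambda>z z'. h (p \<cdot> t (g x' y \<star> f p' z)) z'))" for p x' p'
  define F where "F y z z' = P X (\<lambda>p x. S x (\<lambda>x' p'. h (p \<cdot> t (g x' y \<star> f p' z)) z'))" for y z z'
  note lin = Be_linear_simps[OF f] Be_linear_simps[OF g]
  have d: "dbal (\<lambda>x' p'. h (p \<cdot> t (g x' y \<star> f p' z)) z')" for p y z z'
    using h by (simp add: balanced_def lin)
  have o: "obal (\<lambda>p x. S x (\<lambda>x' p'. h (p \<cdot> t (g x' y \<star> f p' z)) z'))" for y z z'
    \<comment> \<open>The rules for \<open>S\<close> must act before simplification changes the form of the summand.\<close>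
    by (rule balancedI; (subst S_add[OF d] S_tgt_left[OF d])?)
      (use h in \<open>simp_all add: balanced_def lin cop_sum_distrib\<close>)
  have inner: "sharp_pull f h (x \<cdot> t (g x' y)) w = P x (\<lambda>p p'. S w (\<lambda>z z'. h (p \<cdot> t (g x' y \<star> f p' z)) z'))"
    for x x' y w
    by (simp add: sharp_pull_swap P_tgt_right[OF sharp_pull_obal[OF f h]] lin) (simp only: cop_pm_sum_swap)
  have "sharp_pull g (sharp_pull f h) X Y = P X (\<lambda>x x'. P x (\<lambda>p p'. H p x' p'))"
    unfolding sharp_pull_def[of g] inner H_def by (simp only: cop_pm_sum_swap)
  also have "\<dots> = P X (\<lambda>p x. S x (H p))"
  proof (rule P_cop_minus[symmetric])
    show "dbal (H p)" for p
      unfolding H_def by (intro balanced_cop_sum) (use h in \<open>simp add: balanced_def lin\<close>)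
    show "obal (\<lambda>p p'. H p x' p')" for x'
      unfolding H_def by (intro balanced_cop_sum) (use h in \<open>simp add: balanced_def lin\<close>)
  qed
  also have "\<dots> = S Y (\<lambda>y w. S w (\<lambda>z z'. F y z z'))"
  proof -
    have "S x (H p) = S Y (\<lambda>y w. S w (\<lambda>z z'. S x (\<lambda>x' p'. h (p \<cdot> t (g x' y \<star> f p' z)) z')))" for x p
      unfolding H_def by (subst cop_sum_swap) (intro cop_sum_cong cop_sum_swap)
    then show ?thesis by (simp only: pm_cop_sum_swap F_def)
  qed
  also have "\<dots> = S Y (\<lambda>w z'. S w (\<lambda>y z. F y z z'))"
  proof (rule S_coassoc[symmetric])
    show "dbal (\<lambda>y z. F y z z')" for z'
    proof (rule balancedI)
      fix b y z
      have "S x (\<lambda>x' p'. h (p \<cdot> t (g x' (t b \<cdot> y) \<star> f p' z)) z') =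
          S x (\<lambda>x' p'. h (p \<cdot> t (g x' y \<star> f p' (s b \<cdot> z))) z')" for x p
        using S_takeuchi[OF d] by (simp add: lin)
      then show "F (t b \<cdot> y) z z' = F y (s b \<cdot> z) z'" by (simp add: F_def)
    qed (use h in \<open>simp_all add: F_def lin balanced_def pm_sum_distrib cop_sum_distrib\<close>)
    \<comment> \<open>A factor \<open>t(b)\<close> at \<open>z\<close> moves to the right of \<open>p'\<close>, out of \<open>\<Delta>(x)\<close>, and to the left of \<open>p\<close>.\<close>
    show "dbal (\<lambda>z z'. F y z z')" for y
    proof (rule balancedI)
      fix b z z'
      have "F y (t b \<cdot> z) z' = P X (\<lambda>p x. S (x \<cdot> t b) (\<lambda>x' p'. h (p \<cdot> t (g x' y \<star> f p' z)) z'))"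
        unfolding F_def S_tgt_right[OF d] by (simp add: lin)
      also have "\<dots> = F y z (s b \<cdot> z')"
        unfolding F_def using P_takeuchi[OF o[of y z z'], of X b] h by (simp add: balanced_def)
      finally show "F y (t b \<cdot> z) z' = F y z (s b \<cdot> z')" .
    qed (use h in \<open>simp_all add: F_def lin balanced_def pm_sum_distrib cop_sum_distrib\<close>)
  qed
  also have "\<dots> = sharp_pull (convolution L g f) h X Y"
  proof -
    have conv: "S w (\<lambda>y z. S x (\<lambda>x' p'. h (p \<cdot> t (g x' y \<star> f p' z)) z')) =
        h (p \<cdot> t (convolution L g f x w)) z'" for w p x z'
    proof -
      have "h (p \<cdot> t (S W b)) z' = S W (\<lambda>x y. h (p \<cdot> t (b x y)) z')" for W b
        using h by (intro cop_sum_additive[of "\<lambda>b. h (p \<cdot> t b) z'"]) (simp add: balanced_def)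
      then show ?thesis by (simp add: convolution_S2 S2_def)
    qed
    have "S w (\<lambda>y z. F y z z') = P X (\<lambda>p x. h (p \<cdot> t (convolution L g f x w)) z')" for w z'
      unfolding F_def by (simp only: cop_pm_sum_swap conv)
    then show ?thesis by (simp add: sharp_pull_swap)
  qed
  finally show ?thesis .
qed

lemma sharp_pull_counit:
  assumes h: "dbal h"
  shows "sharp_pull (\<lambda>X Y. e (X \<cdot> Y)) h X Y = h X Y"
proof -
  have "P X (\<lambda>x x'. h (x \<cdot> t (e (x' \<cdot> y))) y') = h X (s (e y) \<cdot> y')" for y y'
  proof -
    have "obal (\<lambda>x x'. h (x \<cdot> t (e x')) y')" using h by (simp add: balanced_def)
    from P_takeuchi[OF this, of X "e y"]
    have "P X (\<lambda>x x'. h (x \<cdot> t (e (x' \<cdot> y))) y') = P X (\<lambda>x x'. h (t (e y) \<cdot> (x \<cdot> t (e x'))) y')"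
      by (simp add: cou_mult)
    also have "\<dots> = h (t (e y) \<cdot> X) y'"
      using h by (intro P_counit[of "\<lambda>x. h (t (e y) \<cdot> x) y'"]) (simp add: balanced_def)
    finally show ?thesis using h by (simp add: balanced_def)
  qed
  then show ?thesis
    using h S_counit_left[of "h X" Y] by (simp add: sharp_pull_swap balanced_def)
qed

lemma sharp_pull_inverse: "dbal h \<Longrightarrow> sharp_pull G (sharp_pull G' h) = h" "dbal h \<Longrightarrow> sharp_pull G' (sharp_pull G h) = h"
  using inverse unfolding convolution_inverse_def
  by (intro ext; simp only: sharp_pull_comp[OF G'_Be G_Be] sharp_pull_comp[OF G_Be G'_Be] sharp_pull_counit)+

text \<open>
  The map of \<open>sharp_pull\<close> on formal sums.
\<close>

definition sharp :: "('l \<Rightarrow> 'l \<Rightarrow> 'b) \<Rightarrow> ('l \<times> 'l) multiset \<Rightarrow> ('l \<times> 'l) multiset" where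
  "sharp f u = (\<Sum>(X, Y)\<in>#u. \<Sum>(x, x')\<in>#pm L X. {#(x \<cdot> t (f x' y), y'). (y, y') \<in># sw L Y#})"

lemma sum_sharp: "(\<Sum>(x, y)\<in>#sharp f u. h x y) = (\<Sum>(X, Y)\<in>#u. sharp_pull f h X Y)"
  by (simp add: sharp_def sharp_pull_def cop_sum_def pm_sum_def case_prod_unfold image_mset.compositionality
      comp_def sum_mset_sum_mset)

lemma sharp_cong: "Be_linear L f \<Longrightarrow> (u, v) \<in> dia L \<Longrightarrow> (sharp f u, sharp f v) \<in> dia L"
  unfolding tcong_iff[of "sharp f u"] sum_sharp
  by (rule balanced_sum_cong[OF _ sharp_pull_dbal[OF _ balanced_tensor_class]])

lemma sharp_inverse: "(sharp G (sharp G' u), u) \<in> dia L" "(sharp G' (sharp G u), u) \<in> dia L"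
  unfolding tcong_iff sum_sharp by (simp_all add: sharp_pull_inverse balanced_tensor_class)

lemma cotwist_sharp_class: "cotwist_sharp L G (dia L `` {u}) = dia L `` {sharp G u}"
  unfolding cotwist_sharp_def sharp_def[symmetric]
  by (rule induced_class[OF equiv_dia equiv_dia sharp_cong[OF G_Be]])

lemma inj_cotwist_sharp: "inj_on (cotwist_sharp L G) (UNIV // dia L)"
proof (rule inj_onI)
  fix A B assume "A \<in> UNIV // dia L" "B \<in> UNIV // dia L" and eq: "cotwist_sharp L G A = cotwist_sharp L G B"
  then obtain u v where A: "A = dia L `` {u}" and B: "B = dia L `` {v}" by (auto simp: quotient_def)
  have "(sharp G u, sharp G v) \<in> dia L"
    using eq unfolding A B cotwist_sharp_class by (rule eq_equiv_class[OF _ equiv_dia]) simp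
  then have "(sharp G' (sharp G u), sharp G' (sharp G v)) \<in> dia L" by (rule sharp_cong[OF G'_Be])
  then have "(u, v) \<in> dia L"
    using sharp_inverse(2) by (meson formal_cong.sym formal_cong.trans)
  then show "A = B" unfolding A B by (rule equiv_class_eq[OF equiv_dia])
qed

text \<open>
  The tensor product \<open>L \<diamondop> L\<close> is formed with the left actions of the base only; as the twists preserve
  them, it is the same one for \<open>L\<close> and both twists.
\<close>

lemma twisted_actions:
  "cotwist_mult L G (s b) X = s b \<cdot> X" "cotwist_mult L G (t b) X = t b \<cdot> X"
  "drinfeld_mult (s b) X = s b \<cdot> X" "drinfeld_mult (t b) X = t b \<cdot> X"
proof -
  have d: "dbal (\<lambda>x x'. s (G x y) \<cdot> right_twisted x' y')" for y y'
    by (simp add: balanced_def G right_twisted_linear)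
  have c: "S X (\<lambda>y y'. s (e y) \<cdot> y') = X" "S X (\<lambda>y y'. t (e y') \<cdot> y) = X" for X
    using S_counit_left[of "\<lambda>x. x" X] S_counit_right[of "\<lambda>x. x" X] by simp_all
  show "cotwist_mult L G (s b) X = s b \<cdot> X"
    by (simp add: cotwist_mult_S2 S2_def S_src[OF d] G right_twisted_linear c flip: mult_additive_sums)
  have "cotwist_mult L G (t b) X = t b \<cdot> S X (\<lambda>y y'. s (e y) \<cdot> y')"
    by (simp add: cotwist_mult_S2 S2_def S_tgt[OF d] right_twisted_linear mult_additive_sums tgt_src_left)
  then show "cotwist_mult L G (t b) X = t b \<cdot> X" by (simp add: c)
  note d2 = dbal2_left[OF dbal2_drinfeld]
  have d3: "dbal (\<lambda>x2 x3. s (G x1 y1) \<cdot> (t (G' x3 y3) \<cdot> (x2 \<cdot> y2)))" for x1 y1 y2 y3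
    by (simp add: balanced_def G)
  have c3: "S X (\<lambda>y w. S w (\<lambda>y2 y3. s (e y) \<cdot> (t (e y3) \<cdot> y2))) = X"
    by (simp add: c flip: mult_additive_sums)
  have "drinfeld_mult (s b) X = s b \<cdot> S X (\<lambda>y w. S w (\<lambda>y2 y3. s (e y) \<cdot> (t (e y3) \<cdot> y2)))"
    unfolding drinfeld_mult_S2 S2_def S_src[OF d2[unfolded S2_def]] S_one[OF d3]
    by (simp add: G mult_additive_sums)
  then show "drinfeld_mult (s b) X = s b \<cdot> X" by (simp only: c3)
  have "drinfeld_mult (t b) X = t b \<cdot> S X (\<lambda>y w. S w (\<lambda>y2 y3. s (e y) \<cdot> (t (e y3) \<cdot> y2)))"
    unfolding drinfeld_mult_S2 S2_def S_tgt[OF d2[unfolded S2_def]] S_tgt[OF d3]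
    by (simp add: G mult_additive_sums tgt_src_left)
  then show "drinfeld_mult (t b) X = t b \<cdot> X" by (simp only: c3)
qed

text \<open>
  As \<open>sharp G\<close> and \<open>sharp G'\<close> are mutually inverse, \<open>\<Delta>\<^sup>\<Gamma>\<close> is \<open>\<Delta>\<close> followed by \<open>sharp G'\<close>.
\<close>

lemma cop_cotwist:
  "cop (cotwist L G) X = dia L `` {sharp G' (sw L X)}"
proof -
  have "dia (L\<lparr>amult := cotwist_mult L G\<rparr>) = dia L"
    by (simp add: twisted_actions)
  moreover have "the_inv_into (UNIV // dia L) (cotwist_sharp L G) (cop L X) = dia L `` {sharp G' (sw L X)}"
  proof (rule the_inv_into_f_eq[OF inj_cotwist_sharp])
    show "cotwist_sharp L G (dia L `` {sharp G' (sw L X)}) = cop L X"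
      unfolding cotwist_sharp_class
      using equiv_class_eq[OF equiv_dia sharp_inverse(1)] cop_eq_class[OF sw_in, of X] by simp
  qed (auto intro: quotientI)
  ultimately show ?thesis by (simp add: cotwist_def)
qed

lemma dbal_\<Psi>\<Psi>: "dbal h \<Longrightarrow> dbal (\<lambda>x y. h (\<Psi> x) (\<Psi> y))"
  by (simp add: balanced_def)

text \<open>
  \<open>sharp G'\<close> maps \<open>\<Delta>(X)\<close> to \<open>\<Psi>\<^sup>-\<^sup>1(X\<^sub>1) \<diamondop> X\<^sub>2\<close>, whose image under \<open>\<Psi> \<diamondop> \<Psi>\<close> is \<open>X\<^sub>1 \<diamondop> \<Psi>(X\<^sub>2)\<close>.
\<close>

lemma sharp_pull_\<Psi>:
  assumes h: "dbal h"
  shows "S X (sharp_pull G' (\<lambda>x y. h (\<Psi> x) (\<Psi> y))) = S (\<Psi> X) h"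
proof -
  define F where "F x y y' = P x (\<lambda>p q. h (\<Psi> (p \<cdot> t (G' q y))) (\<Psi> y'))" for x y y'
  note o = sharp_pull_obal[OF G'_Be dbal_\<Psi>\<Psi>[OF h]]
  have F1: "dbal (\<lambda>x y. F x y y')" for y'
    unfolding F_def
    by (rule balancedI)
      (use h in \<open>simp_all add: P_add[OF o] P_tgt_left[OF o] G balanced_def pm_sum_distrib\<close>)
  have F2: "dbal (F x)" for x
    using sharp_pull_dbal_inner[OF G'_Be dbal_\<Psi>\<Psi>[OF h], of x] by (simp add: F_def[abs_def])
  have "S X (sharp_pull G' (\<lambda>x y. h (\<Psi> x) (\<Psi> y))) = S X (\<lambda>x w. S w (F x))"
    by (intro cop_sum_cong) (simp add: sharp_pull_swap F_def[abs_def])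
  also have "\<dots> = S X (\<lambda>w y'. S w (\<lambda>x y. F x y y'))"
    by (rule S_coassoc[symmetric, OF F1 F2])
  also have "\<dots> = S X (\<lambda>w y'. h (\<Psi> (\<Phi> w)) (\<Psi> y'))"
  proof -
    have add: "h (\<Psi> (u + v)) y = h (\<Psi> u) y + h (\<Psi> v) y" for u v y
      using h by (simp add: balanced_def)
    show ?thesis
      unfolding \<Phi> \<Phi>'_def[abs_def] F_def
      by (simp only: cop_sum_additive[of "\<lambda>x. h (\<Psi> x) y" for y, OF add]
          pm_sum_additive[of "\<lambda>x. h (\<Psi> x) y" for y, OF add])
  qed
  also have "\<dots> = S (\<Psi> X) h"
    by (simp add: \<Psi>_\<Phi> S_\<Psi>[OF h])
  finally show ?thesis .
qed

lemma sum_map_\<Psi>: "(\<Sum>(x, y)\<in>#image_mset (map_prod \<Psi> \<Psi>) u. h x y) = (\<Sum>(x, y)\<in>#u. h (\<Psi> x) (\<Psi> y))"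
  by (simp add: case_prod_unfold image_mset.compositionality comp_def)

lemma \<Psi>_cop:
  "induced (dia L) (image_mset (map_prod \<Psi> \<Psi>)) (cop (cotwist L G) X) = cop L (\<Psi> X)"
proof -
  have "(image_mset (map_prod \<Psi> \<Psi>) u, image_mset (map_prod \<Psi> \<Psi>) v) \<in> dia L" if "(u, v) \<in> dia L" for u v
    using balanced_sum_cong[OF that dbal_\<Psi>\<Psi>[OF balanced_tensor_class]] by (simp only: tcong_iff sum_map_\<Psi>)
  then have "induced (dia L) (image_mset (map_prod \<Psi> \<Psi>)) (cop (cotwist L G) X) =
      dia L `` {image_mset (map_prod \<Psi> \<Psi>) (sharp G' (sw L X))}"
    unfolding cop_cotwist by (rule induced_class[OF equiv_dia equiv_dia])
  also have "\<dots> = cop L (\<Psi> X)"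
  proof -
    have "(image_mset (map_prod \<Psi> \<Psi>) (sharp G' (sw L X)), sw L (\<Psi> X)) \<in> dia L"
      unfolding tcong_iff sum_map_\<Psi> sum_sharp
      by (rule sharp_pull_\<Psi>[OF balanced_tensor_class, unfolded cop_sum_def])
    then have "dia L `` {image_mset (map_prod \<Psi> \<Psi>) (sharp G' (sw L X))} = dia L `` {sw L (\<Psi> X)}"
      by (rule equiv_class_eq[OF equiv_dia])
    then show ?thesis using cop_eq_class[OF sw_in, of "\<Psi> X"] by (rule HOL.trans[OF _ HOL.sym])
  qed
  finally show ?thesis .
qed

lemma cou_cotwist: "cou (cotwist L G) X = \<phi> X"
  by (simp add: cotwist_def \<phi>_def pm_sum_def)

section \<open>The isomorphism\<close>

lemma twist_fields:
  "scal (cotwist L G) = scal L" "amult (cotwist L G) = cotwist_mult L G" "aone (cotwist L G) = aone L"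
  "src (cotwist L G) = s" "tgt (cotwist L G) = t"
  "scal (drinfeld_cotwist L G G') = scal L" "aone (drinfeld_cotwist L G G') = aone L"
  "base (drinfeld_cotwist L G G') = base L" "src (drinfeld_cotwist L G G') = s"
  "tgt (drinfeld_cotwist L G G') = t" "cop (drinfeld_cotwist L G G') = cop L"
  "cou (drinfeld_cotwist L G G') = e"
  unfolding cotwist_def drinfeld_cotwist_def by (rule algebroid.cases[of L]; simp)+

text \<open>
  Scalars act through the source map, so linearity over the field follows from linearity over the base.
\<close>

lemma scal_mult: "scal L k X = s (scal (base L) k \<^bold>1\<^bsub>base L\<^esub>) \<cdot> X"
proof -
  have "s (scal (base L) k \<^bold>1\<^bsub>base L\<^esub>) = scal L k \<^bold>1"
    using bialgebroid
    by (simp add: left_bialgebroid_def algebra_map_def Vector_Spaces.linear_def module_hom_def module_hom_axioms_def)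
  moreover have "scal L k \<^bold>1 \<cdot> X = scal L k X"
    using bialgebroid
    by (simp add: left_bialgebroid_def unital_algebra_def Vector_Spaces.linear_def module_hom_def module_hom_axioms_def)
  ultimately show ?thesis by simp
qed

lemma \<Psi>_algebra_map: "algebra_map (cotwist L G) (drinfeld_cotwist L G G') \<Psi>"
proof -
  have "vector_space (scal L)"
    using bialgebroid by (simp add: left_bialgebroid_def unital_algebra_def)
  moreover have "\<Psi> (scal L k X) = scal L k (\<Psi> X)" for k X
    by (simp add: scal_mult)
  ultimately have "Vector_Spaces.linear (scal L) (scal L) \<Psi>"
    by (simp add: Vector_Spaces.linear_def module_hom_def module_hom_axioms_def vector_space_def Modules.module_def)
  then show ?thesis
    using \<Psi>_mult by (simp add: algebra_map_def twist_fields)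
qed

lemma \<Psi>_iso: "hopf_algebroid_iso (cotwist L G) (drinfeld_cotwist L G G') \<Psi>"
proof -
  have "dia (drinfeld_cotwist L G G') = dia L"
    by (simp add: twist_fields twisted_actions)
  moreover have "base (cotwist L G) = base L"
  proof -
    have "base (cotwist L G) = (base L)\<lparr>amult := \<lambda>a b. G (s a) (s b)\<rparr>"
      by (simp add: cotwist_def)
    also have "(\<lambda>a b. G (s a) (s b)) = amult (base L)" by (simp add: G fun_eq_iff)
    finally show ?thesis by simp
  qed
  moreover have "bij \<Psi>"
    using \<Phi>_\<Psi> \<Psi>_\<Phi> by (metis bijI')
  moreover have "\<Psi> (s b) = s b" "\<Psi> (t b) = t b" for b
    using \<Psi>_linear(2)[of b "\<^bold>1"] \<Psi>_linear(3)[of b "\<^bold>1"] by simp_all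
  ultimately show ?thesis
    using \<Psi>_algebra_map \<Psi>_cop by (simp add: hopf_algebroid_iso_def twist_fields cou_cotwist cou_\<Psi>)
qed

end

theorem theorem3p15:
  fixes L :: "('k::field, 'b::ab_group_add, 'l::ab_group_add) algebroid"
    and \<Gamma> \<Gamma>inv :: "'l \<Rightarrow> 'l \<Rightarrow> 'b"
  assumes "left_hopf_algebroid L"
    and "faithfully_flat_over_base L"
    and "bilinear_left_2_cocycle L \<Gamma>"
    and "convolution_inverse L \<Gamma> \<Gamma>inv"
  shows "hopf_algebroid_iso (cotwist L \<Gamma>) (drinfeld_cotwist L \<Gamma> \<Gamma>inv) (Psi L \<Gamma>)
    \<and> (\<forall>X. Psi_inv L \<Gamma>inv (Psi L \<Gamma> X) = X)
    \<and> (\<forall>X. Psi L \<Gamma> (Psi_inv L \<Gamma>inv X) = X)"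
proof -
  interpret bilinear_cocycle L \<Gamma> \<Gamma>inv
    using assms by unfold_locales (auto simp: left_hopf_algebroid_def)
  show ?thesis using \<Psi>_iso \<Phi>_\<Psi> \<Psi>_\<Phi> by blast
qed

end
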